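(* For every entrywise nonnegative matrix $M\in\mathbb R_+^{m\times m}$, with $\boldsymbol\Delta$ and $\boldsymbol\Theta$ the sets of block diagonal $m\times m$ matrices defined in the context, $$\mu(M,\boldsymbol\Delta)=\inf_{\Theta\in\boldsymbol\Theta}\left\|\Theta^{\frac12}M\Theta^{-\frac12}\right\|.$$
   Context: Fix block sizes $m_1,\dots,m_N\ge1$ with $m_1+\dots+m_N=m$ (blocks of size $1$ allowed). Let $$\boldsymbol\Delta:=\{\mathrm{diag}(\Delta_1,\dots,\Delta_N):\ \Delta_k\in\mathbb R_+^{m_k\times m_k},\ 1\le k\le N\},\qquad \boldsymbol\Theta:=\{\mathrm{diag}(\theta_1I_{m_1},\dots,\theta_NI_{m_N}):\ \theta_k>0,\ 1\le k\le N\},$$ where $\mathbb R_+=[0,\infty)$. $\|\cdot\|$ is the spectral norm (largest singular value). For $A\in\mathbb C^{m\times m}$ and a set $\mathbf D\subset\mathbb C^{m\times m}$, the structured singular value is $$\mu(A,\mathbf D):=\frac1{\inf\{\|\Delta\|:\Delta\in\mathbf D,\ \det(I-A\Delta)=0\}},$$ with $\mu(A,\mathbf D)=0$ if no $\Delta\in\mathbf D$ satisfies $\det(I-A\Delta)=0$. *)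

theory Defs
  imports
    Complex_Main
    "Jordan_Normal_Form.Spectral_Radius"
begin

definition nonneg_mat :: "real mat \<Rightarrow> bool" where
  "nonneg_mat A \<longleftrightarrow> (\<forall>a \<in> elements_mat A. 0 \<le> a)"

text \<open>The largest singular value: the singular values of \<open>A\<close> are the nonnegative square roots
  of the eigenvalues of \<open>A\<^sup>H A\<close>. If \<open>A\<close> has no columns, the value is unspecified.\<close>

definition spectral_norm :: "complex mat \<Rightarrow> real" where
  "spectral_norm A =
     Max {s. 0 \<le> s \<and> eigenvalue (mat_adjoint A * A) (complex_of_real (s\<^sup>2))}"

text \<open>The structured singular value. It can be defined with values in the reals: every \<open>\<Delta>\<close> with
  \<open>det (I - A \<Delta>) = 0\<close> satisfies \<open>1 \<le> \<parallel>A\<parallel> \<parallel>\<Delta>\<parallel>\<close>, so the infimum is positive whenever it is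
  taken over a nonempty set.\<close>

definition structured_singular_value :: "complex mat \<Rightarrow> complex mat set \<Rightarrow> real" where
  "structured_singular_value A \<D> =
     (let S = {\<Delta> \<in> \<D>. det (1\<^sub>m (dim_row A) - A * \<Delta>) = 0}
      in if S = {} then 0 else 1 / Inf (spectral_norm ` S))"

definition Delta_blocks :: "nat list \<Rightarrow> real mat set" where
  "Delta_blocks ms =
     {diag_block_mat Ds | Ds.
        list_all2 (\<lambda>D k. D \<in> carrier_mat k k \<and> nonneg_mat D) Ds ms}"

definition Theta_blocks :: "nat list \<Rightarrow> real mat set" where
  "Theta_blocks ms =
     {diag_block_mat (map2 (\<lambda>t k. t \<cdot>\<^sub>m 1\<^sub>m k) ts ms) | ts.
        length ts = length ms \<and> (\<forall>t \<in> set ts. 0 < t)}"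

text \<open>Real power of a diagonal matrix with positive diagonal; the lemmas below confirm that this
  is meaningful for the square root and its inverse. Off-diagonal entries are ignored.\<close>

definition diag_powr :: "real mat \<Rightarrow> real \<Rightarrow> real mat" where
  "diag_powr A a =
     mat (dim_row A) (dim_col A) (\<lambda>(i, j). if i = j then A $$ (i, i) powr a else 0)"

lemma diag_powr_one:
  assumes "A \<in> carrier_mat n n" "diagonal_mat A" "\<And>i. i < n \<Longrightarrow> 0 < A $$ (i, i)"
  shows "diag_powr A 1 = A"
  using assms by (intro eq_matI) (auto simp: diag_powr_def diagonal_mat_def less_imp_le)

lemma diag_powr_zero:
  assumes "A \<in> carrier_mat n n" "\<And>i. i < n \<Longrightarrow> 0 < A $$ (i, i)"
  shows "diag_powr A 0 = 1\<^sub>m n"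
  using assms by (intro eq_matI) (force simp: diag_powr_def)+

lemma diag_powr_mult:
  assumes "A \<in> carrier_mat n n"
  shows "diag_powr A a * diag_powr A b = diag_powr A (a + b)"
proof (rule eq_matI)
  fix i j assume "i < dim_row (diag_powr A (a + b))" "j < dim_col (diag_powr A (a + b))"
  hence ij: "i < n" "j < n" using assms by (auto simp: diag_powr_def)
  have "(diag_powr A a * diag_powr A b) $$ (i, j) =
      (\<Sum>k<n. (if i = k then A $$ (i, i) powr a else 0) * (if k = j then A $$ (k, k) powr b else 0))"
    using ij assms by (simp add: diag_powr_def scalar_prod_def atLeast0LessThan)
  also have "\<dots> =
      (\<Sum>k<n. if k = i then (if i = j then A $$ (i, i) powr a * A $$ (i, i) powr b else 0) else 0)"
    by (rule sum.cong) auto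
  also have "\<dots> = diag_powr A (a + b) $$ (i, j)"
    using ij assms by (simp add: diag_powr_def powr_add)
  finally show "(diag_powr A a * diag_powr A b) $$ (i, j) = diag_powr A (a + b) $$ (i, j)" .
qed (use assms in \<open>auto simp: diag_powr_def\<close>)

end

theory Submission
  imports
    Defs
    "HOL-Analysis.Function_Topology"
    "HOL-Analysis.Convex_Euclidean_Space"
begin

text \<open>If \<open>M \<Delta> v = v\<close>, then scaling by \<open>D = \<Theta>\<^sup>1\<^sup>/\<^sup>2\<close>, which commutes with \<open>\<Delta>\<close>, gives
  \<open>1 \<le> \<parallel>D M D\<^sup>-\<^sup>1\<parallel> \<parallel>\<Delta>\<parallel>\<close>; this is the easy inequality. For the other one, fix \<open>\<sigma> > 0\<close> and consider the
  functions \<open>f\<^sub>k x = \<parallel>(M x)\<^sub>k\<parallel>\<^sup>2 - \<sigma>\<^sup>2 \<parallel>x\<^sub>k\<parallel>\<^sup>2\<close> of the blocks on the nonnegative unit vectors. Since \<open>M\<close> is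
  nonnegative, they are concave in the squares of the entries of \<open>x\<close>. If some \<open>x\<close> makes all of them
  nonnegative, then rank-one blocks sending \<open>(M x)\<^sub>k\<close> to \<open>x\<^sub>k\<close> form a \<open>\<Delta>\<close> with \<open>M \<Delta> (M x) = M x\<close> and
  \<open>\<parallel>\<Delta>\<parallel> \<le> 1 / \<sigma>\<close>. Otherwise separation and compactness yield weights \<open>\<theta>\<^sub>k > 0\<close> with \<open>\<Sum>k. \<theta>\<^sub>k f\<^sub>k \<le> 0\<close>, which
  says that the scaling by \<open>\<theta>\<close> brings the norm of \<open>M\<close> down to at most \<open>\<sigma>\<close>.\<close>

section \<open>Alternatives for concave functions\<close>

text \<open>Ky Fan's notion. The domain needs no linear structure: one point \<open>z\<close>,
  common to all indices, takes the place of the convex combination. This suits the unit sphere,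
  which is not convex but is closed under root mean squares.\<close>

definition concavelike :: "'a set \<Rightarrow> 'i set \<Rightarrow> ('i \<Rightarrow> 'a \<Rightarrow> real) \<Rightarrow> bool" where
  "concavelike C I f \<longleftrightarrow>
     (\<forall>x\<in>C. \<forall>y\<in>C. \<forall>t\<in>{0..1}. \<exists>z\<in>C. \<forall>i\<in>I. (1 - t) * f i x + t * f i y \<le> f i z)"

lemma concavelike_mono: "concavelike C J f \<Longrightarrow> I \<subseteq> J \<Longrightarrow> concavelike C I f"
  unfolding concavelike_def by (meson subsetD)

lemma concavelike_superlevel:
  assumes "concavelike C I f" "j \<in> I"
  shows "concavelike {x \<in> C. 0 < f j x} I f"
  unfolding concavelike_def
proof (intro ballI)
  fix x y t assume x: "x \<in> {x \<in> C. 0 < f j x}" and y: "y \<in> {x \<in> C. 0 < f j x}"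
    and t: "t \<in> {0..1::real}"
  then obtain z where z: "z \<in> C" "\<forall>i\<in>I. (1 - t) * f i x + t * f i y \<le> f i z"
    using assms(1) unfolding concavelike_def by blast
  have "0 < (1 - t) * f j x + t * f j y"
  \<comment> \<open>Strictness comes from \<open>x\<close> if \<open>t < 1\<close> and from
    \<open>y\<close> if \<open>t = 1\<close>.\<close>
  proof (cases "t = 1")
    case False
    then have "0 < (1 - t) * f j x" "0 \<le> t * f j y" using x y t by auto
    then show ?thesis by linarith
  qed (use y in auto)
  then have "0 < f j z" using z assms(2) by fastforce
  then show "\<exists>z\<in>{x \<in> C. 0 < f j x}. \<forall>i\<in>I. (1 - t) * f i x + t * f i y \<le> f i z"
    using z by blast
qed

text \<open>A line through the origin separates it from the region below the values of
  \<open>(g, h)\<close>. That region extends downwards without bound in both coordinates, which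
  fixes the signs of the normal vector; scaling then gives \<open>p\<close> and
  \<open>q\<close>.\<close>

lemma concavelike_pair_alternative:
  fixes g h :: "'a \<Rightarrow> real"
  assumes cc: "\<And>x y t. x \<in> C \<Longrightarrow> y \<in> C \<Longrightarrow> 0 \<le> t \<Longrightarrow> t \<le> 1 \<Longrightarrow>
      \<exists>z\<in>C. (1 - t) * g x + t * g y \<le> g z \<and> (1 - t) * h x + t * h y \<le> h z"
    and alt: "\<And>x. x \<in> C \<Longrightarrow> 0 < h x \<Longrightarrow> g x \<le> 0"
  obtains p q :: real where "0 \<le> p" "0 \<le> q" "p + q = 1" "\<And>x. x \<in> C \<Longrightarrow> p * g x + q * h x \<le> 0"
proof (cases "C = {}")
  case True
  then show ?thesis using that[of 1 0] by auto
next
  case False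
  then obtain x0 where x0: "x0 \<in> C" by blast
  \<comment> \<open>Passing to all points strictly below the image of \<open>C\<close> gives a
    convex set even where the image is not convex. A point of \<open>C\<close> with both values
    positive is exactly what \<open>0 \<in> S\<close> would mean.\<close>
  define S where "S = {(s, t). \<exists>x\<in>C. s < g x \<and> t < h x}"
  have "convex S"
    unfolding convex_alt
  proof (intro ballI allI impI)
    fix u v :: "real \<times> real" and t :: real
    assume "u \<in> S" "v \<in> S" and t: "0 \<le> t \<and> t \<le> 1"
    then obtain x y where x: "x \<in> C" "fst u < g x" "snd u < h x"
      and y: "y \<in> C" "fst v < g y" "snd v < h y"
      unfolding S_def by auto
    obtain z where z: "z \<in> C" "(1 - t) * g x + t * g y \<le> g z" "(1 - t) * h x + t * h y \<le> h z"
      using cc x(1) y(1) t by blast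
    have less: "(1 - t) * a + t * b < (1 - t) * c + t * d" if "a < c" "b < d" for a b c d
    proof (cases "t = 1")
      case False
      then have "(1 - t) * a < (1 - t) * c" using t that by simp
      moreover have "t * b \<le> t * d" using t that by (intro mult_left_mono) auto
      ultimately show ?thesis by linarith
    qed (use that in auto)
    have "fst ((1 - t) *\<^sub>R u + t *\<^sub>R v) < g z" "snd ((1 - t) *\<^sub>R u + t *\<^sub>R v) < h z"
      using less[OF x(2) y(2)] less[OF x(3) y(3)] z by auto
    then show "(1 - t) *\<^sub>R u + t *\<^sub>R v \<in> S"
      unfolding S_def using z(1) by (auto simp: case_prod_beta)
  qed
  moreover have "0 \<notin> S"
  proof
    assume "0 \<in> S"
    then obtain x where "x \<in> C" "0 < g x" "0 < h x" by (auto simp: S_def zero_prod_def)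
    then show False using alt[of x] by simp
  qed
  ultimately obtain c where c0: "c \<noteq> 0" and c: "\<And>u. u \<in> S \<Longrightarrow> 0 \<le> inner c u"
    using separating_hyperplane_set_0[of S] by blast
  obtain a b where ab: "c = (a, b)" by (cases c)
  have sep: "0 \<le> a * s + b * t" if "x \<in> C" "s < g x" "t < h x" for s t x
  proof -
    have "(s, t) \<in> S" using that by (auto simp: S_def)
    then show ?thesis using c[of "(s, t)"] by (simp add: ab)
  qed
  \<comment> \<open>If \<open>a\<close> were positive, a sufficiently negative first coordinate
    would push the functional down to \<open>-1\<close> or below on a point of \<open>S\<close>. The
    argument for \<open>b\<close> is symmetric.\<close>
  have "a \<le> 0"
  proof (rule ccontr)
    assume a: "\<not> a \<le> 0"
    define s where "s = min (g x0 - 1) ((- b * (h x0 - 1) - 1) / a)"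
    have "a * s \<le> a * ((- b * (h x0 - 1) - 1) / a)"
      using a by (intro mult_left_mono) (auto simp: s_def)
    also have "\<dots> = - b * (h x0 - 1) - 1" using a by simp
    finally have "a * s + b * (h x0 - 1) < 0" by simp
    moreover have "s < g x0" by (simp add: s_def min_less_iff_disj)
    ultimately show False using sep[OF x0, of s "h x0 - 1"] by simp
  qed
  moreover have "b \<le> 0"
  proof (rule ccontr)
    assume b: "\<not> b \<le> 0"
    define s where "s = min (h x0 - 1) ((- a * (g x0 - 1) - 1) / b)"
    have "b * s \<le> b * ((- a * (g x0 - 1) - 1) / b)"
      using b by (intro mult_left_mono) (auto simp: s_def)
    also have "\<dots> = - a * (g x0 - 1) - 1" using b by simp
    finally have "a * (g x0 - 1) + b * s < 0" by simp
    moreover have "s < h x0" by (simp add: s_def min_less_iff_disj)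
    ultimately show False using sep[OF x0, of "g x0 - 1" s] by simp
  qed
  moreover have "a \<noteq> 0 \<or> b \<noteq> 0" using c0 ab by (auto simp: zero_prod_def)
  ultimately have r: "- a - b > 0" by auto
  \<comment> \<open>The point \<open>(g x, h x)\<close> itself is not known to lie in
    \<open>S\<close>, so it is approached from below along the diagonal, by a shift \<open>d\<close>
    tending to 0.\<close>
  have le: "- a * g x - b * h x \<le> 0" if "x \<in> C" for x
  proof (rule field_le_epsilon)
    fix e :: real assume e: "0 < e"
    define d where "d = e / (- a - b)"
    have d: "0 < d" "d * (- a - b) = e" using e r by (auto simp: d_def)
    have "0 \<le> a * (g x - d) + b * (h x - d)" using sep[OF that] d by auto
    then show "- a * g x - b * h x \<le> 0 + e" using d(2) by (simp add: algebra_simps)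
  qed
  show ?thesis
  proof (rule that)
    show "0 \<le> - a / (- a - b)" using \<open>a \<le> 0\<close> r by (intro divide_nonneg_pos) auto
    show "0 \<le> - b / (- a - b)" using \<open>b \<le> 0\<close> r by (intro divide_nonneg_pos) auto
    have "- a / (- a - b) + - b / (- a - b) = (- a - b) / (- a - b)"
      unfolding add_divide_distrib[symmetric] by simp
    then show "- a / (- a - b) + - b / (- a - b) = 1" using r by simp
    show "- a / (- a - b) * g x + - b / (- a - b) * h x \<le> 0" if "x \<in> C" for x
    proof -
      have "- a / (- a - b) * g x + - b / (- a - b) * h x = (- a * g x - b * h x) / (- a - b)"
        unfolding times_divide_eq_left add_divide_distrib[symmetric] by simp
      also have "\<dots> \<le> 0" using le[OF that] r by (rule divide_nonpos_pos)
      finally show ?thesis .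
    qed
  qed
qed

text \<open>Fan, Glicksberg and Hoffman. In the induction, the function added last forms a pair with the
  weighted sum obtained on its positivity set, and the pair is separated in the plane.\<close>

theorem concavelike_alternative:
  fixes f :: "'i \<Rightarrow> 'a \<Rightarrow> real"
  assumes "finite I" "I \<noteq> {}" "concavelike C I f" "\<And>x. x \<in> C \<Longrightarrow> \<exists>i\<in>I. f i x \<le> 0"
  shows "\<exists>w. (\<forall>i\<in>I. 0 \<le> w i) \<and> sum w I = 1 \<and> (\<forall>x\<in>C. (\<Sum>i\<in>I. w i * f i x) \<le> 0)"
  using assms
proof (induction I arbitrary: C rule: finite_ne_induct)
  case (singleton j)
  then show ?case by (intro exI[of _ "\<lambda>_. 1"]) auto
next
  case (insert j I)
  have "\<exists>w. (\<forall>i\<in>I. 0 \<le> w i) \<and> sum w I = 1 \<and>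
      (\<forall>x\<in>{x \<in> C. 0 < f j x}. (\<Sum>i\<in>I. w i * f i x) \<le> 0)"
  \<comment> \<open>Where \<open>f j\<close> is positive, the index with a nonpositive value must
    lie in \<open>I\<close>.\<close>
  proof (rule insert.IH)
    show "concavelike {x \<in> C. 0 < f j x} I f"
      using concavelike_superlevel[OF insert.prems(1), of j] by (auto intro: concavelike_mono)
    show "\<exists>i\<in>I. f i x \<le> 0" if "x \<in> {x \<in> C. 0 < f j x}" for x
      using insert.prems(2)[of x] that by auto
  qed
  then obtain w where w: "\<And>i. i \<in> I \<Longrightarrow> 0 \<le> w i" "sum w I = 1"
    and wf: "\<And>x. x \<in> C \<Longrightarrow> 0 < f j x \<Longrightarrow> (\<Sum>i\<in>I. w i * f i x) \<le> 0"
    by blast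
  obtain p q where pq: "0 \<le> p" "0 \<le> q" "p + q = 1"
    and le: "\<And>x. x \<in> C \<Longrightarrow> p * (\<Sum>i\<in>I. w i * f i x) + q * f j x \<le> 0"
  proof (rule concavelike_pair_alternative[of C "\<lambda>x. \<Sum>i\<in>I. w i * f i x" "f j"])
    fix x y t assume "x \<in> C" "y \<in> C" "0 \<le> t" "t \<le> (1::real)"
    then obtain z where z: "z \<in> C" "\<And>i. i \<in> insert j I \<Longrightarrow> (1 - t) * f i x + t * f i y \<le> f i z"
      using insert.prems(1) unfolding concavelike_def by (meson atLeastAtMost_iff)
    have "(1 - t) * (\<Sum>i\<in>I. w i * f i x) + t * (\<Sum>i\<in>I. w i * f i y) =
        (\<Sum>i\<in>I. w i * ((1 - t) * f i x + t * f i y))"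
      by (simp add: sum_distrib_left sum.distrib[symmetric] algebra_simps)
    also have "\<dots> \<le> (\<Sum>i\<in>I. w i * f i z)"
      using z(2) w(1) by (intro sum_mono mult_left_mono) auto
    finally show "\<exists>z\<in>C. (1 - t) * (\<Sum>i\<in>I. w i * f i x) + t * (\<Sum>i\<in>I. w i * f i y)
        \<le> (\<Sum>i\<in>I. w i * f i z) \<and> (1 - t) * f j x + t * f j y \<le> f j z"
      using z by blast
  qed (use wf in auto)
  \<comment> \<open>The new index receives \<open>q\<close> and the old weights share
    \<open>p\<close>, so the total stays \<open>p + q = 1\<close>.\<close>
  let ?v = "\<lambda>i. if i = j then q else p * w i"
  have v: "(\<Sum>i\<in>insert j I. ?v i * c i) = q * c j + p * (\<Sum>i\<in>I. w i * c i)" for c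
  proof -
    have "(\<Sum>i\<in>insert j I. ?v i * c i) = q * c j + (\<Sum>i\<in>I. ?v i * c i)"
      using insert.hyps by simp
    also have "(\<Sum>i\<in>I. ?v i * c i) = p * (\<Sum>i\<in>I. w i * c i)"
      using insert.hyps unfolding sum_distrib_left by (intro sum.cong) auto
    finally show ?thesis .
  qed
  show ?case
  proof (intro exI[of _ ?v] conjI ballI)
    show "0 \<le> ?v i" if "i \<in> insert j I" for i
      using that pq w(1) by auto
    show "sum ?v (insert j I) = 1" using v[of "\<lambda>_. 1"] w(2) pq by simp
    show "(\<Sum>i\<in>insert j I. ?v i * f i x) \<le> 0" if "x \<in> C" for x
      using le[OF that] unfolding v by linarith
  qed
qed

text \<open>The sum of the negative parts is continuous and positive on \<open>C\<close>, so it has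
  a positive minimum. At every point, some index carries at least the average share of that
  minimum.\<close>

lemma compact_uniform_negative:
  fixes f :: "'i \<Rightarrow> 'a :: topological_space \<Rightarrow> real"
  assumes "compact C" "finite I" "\<And>i. i \<in> I \<Longrightarrow> continuous_on C (f i)"
    and neg: "\<And>x. x \<in> C \<Longrightarrow> \<exists>i\<in>I. f i x < 0"
  obtains e where "0 < e" "\<And>x. x \<in> C \<Longrightarrow> \<exists>i\<in>I. f i x \<le> - e"
proof (cases "C = {}")
  case True
  then show ?thesis using that[of 1] by auto
next
  case False
  let ?P = "\<lambda>x. \<Sum>i\<in>I. max 0 (- f i x)"
  have "continuous_on C ?P" using assms(3) by (intro continuous_intros) auto
  then obtain x0 where x0: "x0 \<in> C" "\<And>x. x \<in> C \<Longrightarrow> ?P x0 \<le> ?P x"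
    using continuous_attains_inf[OF assms(1) False] by blast
  obtain i0 where i0: "i0 \<in> I" "f i0 x0 < 0" using neg x0 by blast
  have "0 < ?P x0" using i0 \<open>finite I\<close> by (intro sum_pos2[of _ i0]) auto
  moreover have cI: "0 < real (card I)" using i0 \<open>finite I\<close> by (auto simp: card_gt_0_iff)
  ultimately have e: "0 < ?P x0 / card I" by simp
  have "\<exists>i\<in>I. f i x \<le> - (?P x0 / card I)" if "x \<in> C" for x
  proof (rule ccontr)
    assume n: "\<not> (\<exists>i\<in>I. f i x \<le> - (?P x0 / card I))"
    have "?P x < (\<Sum>i\<in>I. ?P x0 / card I)"
      using n e i0(1) \<open>finite I\<close> by (intro sum_strict_mono) (auto simp: not_le)
    also have "\<dots> = ?P x0" using cI by simp
    finally show False using x0(2)[OF that] by simp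
  qed
  then show ?thesis using that e by blast
qed

section \<open>Compactness of unit spheres in function spaces\<close>

lemma compact_box_fun:
  fixes S :: "'i \<Rightarrow> 'b :: topological_space set"
  assumes "\<And>i. compact (S i)"
  shows "compact {x. \<forall>i. x i \<in> S i}"
proof -
  have "compactin (product_topology (\<lambda>i. euclidean) UNIV) (PiE UNIV S)"
    using assms by (simp add: compactin_PiE)
  moreover have "PiE UNIV S = {x. \<forall>i. x i \<in> S i}" by (auto simp: PiE_def)
  ultimately show ?thesis by (simp add: euclidean_product_topology)
qed

text \<open>Vectors are functions vanishing off the finite set \<open>I\<close>, so the dimension
  need not be a type. By Tychonoff the box of coordinates in \<open>cball 0 1 \<inter> T\<close> is
  compact, and the sphere is closed in it. The set \<open>T\<close> allows both nonnegative real
  vectors and all complex ones.\<close>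

lemma compact_unit_sphere_fun:
  fixes I :: "'i set" and T :: "'b :: {real_normed_vector, heine_borel} set"
  assumes "finite I" "closed T"
  shows "compact {x. (\<forall>i\<in>I. x i \<in> T) \<and> (\<forall>i. i \<notin> I \<longrightarrow> x i = 0) \<and> (\<Sum>i\<in>I. (norm (x i))\<^sup>2) = 1}"
proof -
  let ?S = "\<lambda>i. if i \<in> I then cball 0 1 \<inter> T else {0 :: 'b}"
  let ?g = "\<lambda>x. \<Sum>i\<in>I. (norm (x i :: 'b))\<^sup>2"
  have "compact (?S i)" for i using assms by auto
  then have "compact {x. \<forall>i. x i \<in> ?S i}" by (rule compact_box_fun)
  moreover have "continuous_on UNIV ?g" by (intro continuous_intros) simp
  then have "closed (?g -` {1})" by (intro closed_vimage) auto
  ultimately have c: "compact ({x. \<forall>i. x i \<in> ?S i} \<inter> ?g -` {1})" by (rule compact_Int_closed)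
  have "norm (x i) \<le> 1" if "?g x = 1" "i \<in> I" for x i
  proof -
    have "(norm (x i))\<^sup>2 \<le> ?g x" using assms that by (intro member_le_sum) auto
    then show ?thesis using that by (simp add: power_le_one_iff abs_square_le_1)
  qed
  then have "{x. \<forall>i. x i \<in> ?S i} \<inter> ?g -` {1} =
      {x. (\<forall>i\<in>I. x i \<in> T) \<and> (\<forall>i. i \<notin> I \<longrightarrow> x i = 0) \<and> ?g x = 1}"
    by (fastforce split: if_splits)
  then show ?thesis using c by simp
qed

text \<open>The triangle inequality for the plane vectors \<open>(sqrt (1 - t) x\<^sub>j, sqrt t y\<^sub>j)\<close>. It makes the functions
  \<open>x \<mapsto> (\<Sum>j. a\<^sub>j x\<^sub>j)\<^sup>2\<close> concave in the squares of the \<open>x\<^sub>j\<close>.\<close>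

lemma quadratic_mean_sum_ge:
  fixes a x y :: "'i \<Rightarrow> real"
  assumes a: "\<And>j. j \<in> J \<Longrightarrow> 0 \<le> a j" and t: "0 \<le> t" "t \<le> 1"
  shows "(1 - t) * (\<Sum>j\<in>J. a j * x j)\<^sup>2 + t * (\<Sum>j\<in>J. a j * y j)\<^sup>2
    \<le> (\<Sum>j\<in>J. a j * sqrt ((1 - t) * (x j)\<^sup>2 + t * (y j)\<^sup>2))\<^sup>2"
proof -
  define z where "z j = Complex (sqrt (1 - t) * x j) (sqrt t * y j)" for j
  have z: "cmod (z j) = sqrt ((1 - t) * (x j)\<^sup>2 + t * (y j)\<^sup>2)" for j
    using t by (simp add: z_def cmod_def power_mult_distrib)
  have "cmod (\<Sum>j\<in>J. of_real (a j) * z j) \<le> (\<Sum>j\<in>J. cmod (of_real (a j) * z j))"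
    by (rule norm_sum)
  also have "\<dots> = (\<Sum>j\<in>J. a j * cmod (z j))"
    using a by (intro sum.cong) (auto simp: norm_mult)
  finally have "(cmod (\<Sum>j\<in>J. of_real (a j) * z j))\<^sup>2 \<le> (\<Sum>j\<in>J. a j * cmod (z j))\<^sup>2"
    by (intro power_mono) auto
  moreover have "Re (\<Sum>j\<in>J. of_real (a j) * z j) = sqrt (1 - t) * (\<Sum>j\<in>J. a j * x j)"
    by (simp add: z_def sum_distrib_left mult_ac)
  moreover have "Im (\<Sum>j\<in>J. of_real (a j) * z j) = sqrt t * (\<Sum>j\<in>J. a j * y j)"
    by (simp add: z_def sum_distrib_left mult_ac)
  ultimately show ?thesis
    using t by (simp add: cmod_power2 power_mult_distrib z)
qed

section \<open>The dichotomy for blocks of coordinates\<close>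

lemma sum_over_blocks:
  fixes g :: "'i \<Rightarrow> 'c :: comm_semiring_0"
  assumes "finite I"
  shows "(\<Sum>k\<in>b ` I. c k * (\<Sum>i\<in>{i \<in> I. b i = k}. g i)) = (\<Sum>i\<in>I. c (b i) * g i)"
proof -
  have "(\<Sum>i\<in>I. c (b i) * g i) = (\<Sum>k\<in>b ` I. \<Sum>i\<in>{i \<in> I. b i = k}. c (b i) * g i)"
    using assms by (rule sum.image_gen)
  also have "\<dots> = (\<Sum>k\<in>b ` I. c k * (\<Sum>i\<in>{i \<in> I. b i = k}. g i))"
    by (simp add: sum_distrib_left)
  finally show ?thesis by simp
qed

text \<open>Compactness gives a uniform negative margin when there is no gain, and the alternative
  for concavelike families turns it into weights. Both outcomes concern nonnegative \<open>x\<close>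
  only; nonnegativity of \<open>a\<close> is what makes the block functions concavelike.\<close>

lemma block_gain_or_scaling:
  fixes a :: "'i \<Rightarrow> 'i \<Rightarrow> real" and b :: "'i \<Rightarrow> 'k" and \<sigma> :: real
  assumes I: "finite I" "I \<noteq> {}" and a: "\<And>i j. i \<in> I \<Longrightarrow> j \<in> I \<Longrightarrow> 0 \<le> a i j"
  obtains (gain) x where "\<And>i. i \<in> I \<Longrightarrow> 0 \<le> x i" "\<exists>i\<in>I. x i \<noteq> 0"
      "\<And>k. \<sigma>\<^sup>2 * (\<Sum>i\<in>{i \<in> I. b i = k}. (x i)\<^sup>2)
        \<le> (\<Sum>i\<in>{i \<in> I. b i = k}. (\<Sum>j\<in>I. a i j * x j)\<^sup>2)"
  | (scaling) \<theta> where "\<And>k. 0 < \<theta> k"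
      "\<And>x. (\<And>i. i \<in> I \<Longrightarrow> 0 \<le> x i) \<Longrightarrow>
        (\<Sum>i\<in>I. \<theta> (b i) * (\<Sum>j\<in>I. a i j * x j)\<^sup>2) \<le> \<sigma>\<^sup>2 * (\<Sum>i\<in>I. \<theta> (b i) * (x i)\<^sup>2)"
proof -
  define C where "C = {x :: 'i \<Rightarrow> real. (\<forall>i\<in>I. x i \<in> {0..}) \<and> (\<forall>i. i \<notin> I \<longrightarrow> x i = 0) \<and>
    (\<Sum>i\<in>I. (norm (x i))\<^sup>2) = 1}"
  have C: "compact C" unfolding C_def using I by (intro compact_unit_sphere_fun) auto
  define K where "K = b ` I"
  have K: "finite K" "K \<noteq> {}" using I by (auto simp: K_def)
  define g where "g i x = (\<Sum>j\<in>I. a i j * x j)\<^sup>2 - \<sigma>\<^sup>2 * (x i)\<^sup>2" for i x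
  define f where "f k x = (\<Sum>i\<in>{i \<in> I. b i = k}. g i x)" for k x
  have cont: "continuous_on C (f k)" for k
    unfolding f_def g_def
    by (intro continuous_intros continuous_on_subset[OF continuous_on_product_coordinates]) auto
  show thesis
  proof (cases "\<exists>x\<in>C. \<forall>k\<in>K. 0 \<le> f k x")
    case True
    then obtain x where x: "x \<in> C" "\<And>k. k \<in> K \<Longrightarrow> 0 \<le> f k x" by blast
    show thesis
    proof (rule gain)
      show "0 \<le> x i" if "i \<in> I" for i using x that by (auto simp: C_def)
      show "\<exists>i\<in>I. x i \<noteq> 0"
      proof (rule ccontr)
        assume "\<not> ?thesis"
        then have "(\<Sum>i\<in>I. (norm (x i))\<^sup>2) = 0" by (intro sum.neutral) auto
        then show False using x by (auto simp: C_def)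
      qed
      show "\<sigma>\<^sup>2 * (\<Sum>i\<in>{i \<in> I. b i = k}. (x i)\<^sup>2)
        \<le> (\<Sum>i\<in>{i \<in> I. b i = k}. (\<Sum>j\<in>I. a i j * x j)\<^sup>2)" for k
      proof (cases "k \<in> K")
        case True
        then show ?thesis
          using x(2)[of k] by (simp add: f_def g_def sum_subtractf sum_distrib_left)
      next
        case False
        then have "{i \<in> I. b i = k} = {}" by (auto simp: K_def)
        then show ?thesis by (simp only: sum.empty mult_zero_right)
      qed
    qed
  next
    case False
    then have "\<exists>k\<in>K. f k x < 0" if "x \<in> C" for x using that by force
    then obtain e where e: "0 < e" and fe: "\<And>x. x \<in> C \<Longrightarrow> \<exists>k\<in>K. f k x \<le> - e"
      using compact_uniform_negative[OF C \<open>finite K\<close>, of f] cont by blast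
    \<comment> \<open>The alternative is applied to the functions raised by the margin
      \<open>e\<close>, so that the resulting weighted inequality has room for perturbing the
      weights.\<close>
    have "concavelike C K (\<lambda>k x. f k x + e)"
      unfolding concavelike_def
    proof (intro ballI)
      fix x y t assume x: "x \<in> C" and y: "y \<in> C" and "t \<in> {0..1::real}"
      then have t: "0 \<le> t" "t \<le> 1" by auto
      \<comment> \<open>The convex combination taken in the squares of the coordinates: it stays on
        the unit sphere, leaves the terms \<open>(x i)\<^sup>2\<close> affine and makes the squared
        linear forms concave.\<close>
      define z where "z i = sqrt ((1 - t) * (x i)\<^sup>2 + t * (y i)\<^sup>2)" for i
      have z2: "(z i)\<^sup>2 = (1 - t) * (x i)\<^sup>2 + t * (y i)\<^sup>2" for i
        using t by (simp add: z_def)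
      have "(\<Sum>i\<in>I. (z i)\<^sup>2) = (1 - t) * (\<Sum>i\<in>I. (x i)\<^sup>2) + t * (\<Sum>i\<in>I. (y i)\<^sup>2)"
        by (simp add: z2 sum.distrib sum_distrib_left)
      then have "z \<in> C" using x y t by (auto simp: C_def z_def)
      moreover have g: "(1 - t) * g i x + t * g i y \<le> g i z" if "i \<in> I" for i
      proof -
        have "(1 - t) * (\<Sum>j\<in>I. a i j * x j)\<^sup>2 + t * (\<Sum>j\<in>I. a i j * y j)\<^sup>2
            \<le> (\<Sum>j\<in>I. a i j * z j)\<^sup>2"
          unfolding z_def using a that t by (intro quadratic_mean_sum_ge) auto
        then show ?thesis unfolding g_def z2 by (simp add: algebra_simps)
      qed
      have "(1 - t) * (f k x + e) + t * (f k y + e) \<le> f k z + e" for k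
      proof -
        have "(1 - t) * f k x + t * f k y =
            (\<Sum>i\<in>{i \<in> I. b i = k}. (1 - t) * g i x + t * g i y)"
          by (simp add: f_def sum.distrib sum_distrib_left)
        also have "\<dots> \<le> f k z" unfolding f_def by (intro sum_mono g) auto
        finally show ?thesis by (simp add: algebra_simps)
      qed
      ultimately show "\<exists>z\<in>C. \<forall>k\<in>K. (1 - t) * (f k x + e) + t * (f k y + e) \<le> f k z + e"
        by blast
    qed
    moreover have "\<exists>k\<in>K. f k x + e \<le> 0" if "x \<in> C" for x using fe[OF that] by force
    ultimately obtain w where w: "\<And>k. k \<in> K \<Longrightarrow> 0 \<le> w k" "sum w K = 1"
      and wf: "\<And>x. x \<in> C \<Longrightarrow> (\<Sum>k\<in>K. w k * (f k x + e)) \<le> 0"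
      using concavelike_alternative[OF K, of C "\<lambda>k x. f k x + e"] by blast
    have "continuous_on C (\<lambda>x. \<Sum>k\<in>K. f k x)" using cont by (intro continuous_intros)
    then have "bounded ((\<lambda>x. \<Sum>k\<in>K. f k x) ` C)"
      using C by (intro compact_imp_bounded compact_continuous_image)
    then obtain B where B: "0 < B" "\<And>x. x \<in> C \<Longrightarrow> \<bar>\<Sum>k\<in>K. f k x\<bar> \<le> B"
      unfolding bounded_pos by auto
    \<comment> \<open>The margin \<open>e\<close> pays for making all weights positive.\<close>
    define \<theta> where "\<theta> k = (if k \<in> K then w k else 0) + e / B" for k
    have on_C: "(\<Sum>i\<in>I. \<theta> (b i) * g i x) \<le> 0" if x: "x \<in> C" for x
    proof -
      have "(\<Sum>i\<in>I. \<theta> (b i) * g i x) = (\<Sum>k\<in>K. \<theta> k * f k x)"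
        unfolding K_def f_def by (rule sum_over_blocks[OF I(1), symmetric])
      also have "\<dots> = (\<Sum>k\<in>K. w k * (f k x + e)) - sum w K * e + e / B * (\<Sum>k\<in>K. f k x)"
        by (simp add: \<theta>_def algebra_simps sum.distrib sum_distrib_left)
      also have "\<dots> \<le> 0 - e + e / B * B"
        using wf[OF x] w(2) B(2)[OF x] B(1) e
        by (intro add_mono diff_mono mult_left_mono) auto
      finally show ?thesis using B(1) by simp
    qed
    show thesis
    proof (rule scaling)
      show "0 < \<theta> k" for k using w(1) e B(1) by (auto simp: \<theta>_def add_nonneg_pos)
      fix x :: "'i \<Rightarrow> real" assume x: "\<And>i. i \<in> I \<Longrightarrow> 0 \<le> x i"
      \<comment> \<open>All \<open>g i\<close> are homogeneous of degree two, so the inequality on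
        unit vectors extends to every nonnegative \<open>x\<close>.\<close>
      define r where "r = sqrt (\<Sum>i\<in>I. (x i)\<^sup>2)"
      have r2: "r\<^sup>2 = (\<Sum>i\<in>I. (x i)\<^sup>2)" by (simp add: r_def sum_nonneg)
      have "(\<Sum>i\<in>I. \<theta> (b i) * g i x) \<le> 0"
      proof (cases "r = 0")
        case True
        then have x0: "x i = 0" if "i \<in> I" for i
          using r2 that I(1) by (simp add: sum_nonneg_eq_0_iff)
        show ?thesis by (simp add: g_def x0)
      next
        case False
        define y where "y i = (if i \<in> I then x i / r else 0)" for i
        have "0 \<le> r" by (simp add: r_def sum_nonneg)
        then have "(\<Sum>i\<in>I. (norm (y i))\<^sup>2) = (\<Sum>i\<in>I. (x i)\<^sup>2) / r\<^sup>2"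
          by (simp add: y_def power_divide sum_divide_distrib)
        then have "y \<in> C" using False \<open>0 \<le> r\<close> x r2 by (auto simp: C_def y_def)
        have "g i x = r\<^sup>2 * g i y" if "i \<in> I" for i
        proof -
          have "(\<Sum>j\<in>I. a i j * x j) = r * (\<Sum>j\<in>I. a i j * y j)"
            unfolding sum_distrib_left using False by (intro sum.cong) (auto simp: y_def)
          moreover have "x i = r * y i" using that False by (simp add: y_def)
          ultimately show ?thesis by (simp add: g_def power_mult_distrib algebra_simps)
        qed
        then have "(\<Sum>i\<in>I. \<theta> (b i) * g i x) = r\<^sup>2 * (\<Sum>i\<in>I. \<theta> (b i) * g i y)"
          unfolding sum_distrib_left by (intro sum.cong) auto
        then show ?thesis using on_C[OF \<open>y \<in> C\<close>] by (simp add: mult_nonneg_nonpos)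
      qed
      then show "(\<Sum>i\<in>I. \<theta> (b i) * (\<Sum>j\<in>I. a i j * x j)\<^sup>2) \<le> \<sigma>\<^sup>2 * (\<Sum>i\<in>I. \<theta> (b i) * (x i)\<^sup>2)"
        by (simp add: g_def algebra_simps sum_subtractf sum_distrib_left)
    qed
  qed
qed

section \<open>The spectral norm as an operator norm\<close>

unbundle no vec_syntax
hide_type (open) Finite_Cartesian_Product.vec
hide_const (open) Finite_Cartesian_Product.vec Finite_Cartesian_Product.mat

lemma minus_vec_eq_zeroD:
  fixes a b :: "'a :: ab_group_add vec"
  assumes "a \<in> carrier_vec n" "b \<in> carrier_vec n" "a - b = 0\<^sub>v n"
  shows "a = b"
proof (rule eq_vecI)
  fix i assume "i < dim_vec b"
  then have i: "i < n" using assms by simp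
  then have "a $ i - b $ i = (a - b) $ i" using assms(1,2) by simp
  also have "\<dots> = 0" using i by (simp add: assms(3))
  finally show "a $ i = b $ i" by simp
qed (use assms in auto)

text \<open>The squared Euclidean norm. It is kept squared because the eigenvalues of
  \<open>mat_adjoint A * A\<close> are squares of singular values, and because its expansions are
  polynomial.\<close>

definition vnorm2 :: "complex vec \<Rightarrow> real" where
  "vnorm2 v = (\<Sum>i<dim_vec v. (cmod (v $ i))\<^sup>2)"

lemma vnorm2_nonneg: "0 \<le> vnorm2 v"
  by (simp add: vnorm2_def sum_nonneg)

lemma vnorm2_eq_0_iff:
  assumes "v \<in> carrier_vec n"
  shows "vnorm2 v = 0 \<longleftrightarrow> v = 0\<^sub>v n"
  using assms by (auto simp: vnorm2_def sum_nonneg_eq_0_iff intro!: eq_vecI)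

lemma vnorm2_pos:
  assumes "v \<in> carrier_vec n" "v \<noteq> 0\<^sub>v n"
  shows "0 < vnorm2 v"
  using assms vnorm2_nonneg[of v] vnorm2_eq_0_iff[of v n] by force

lemma cscalar_prod_self: "v \<bullet>c v = complex_of_real (vnorm2 v)"
  by (simp add: scalar_prod_def vnorm2_def atLeast0LessThan complex_norm_square del: of_real_power)

lemma vnorm2_add_smult:
  assumes "u \<in> carrier_vec n" "v \<in> carrier_vec n"
  shows "vnorm2 (v + complex_of_real r \<cdot>\<^sub>v u) = vnorm2 v + 2 * r * Re (v \<bullet>c u) + r\<^sup>2 * vnorm2 u"
proof -
  have "(cmod (x + complex_of_real r * y))\<^sup>2 = (cmod x)\<^sup>2 + 2 * r * Re (x * cnj y) + r\<^sup>2 * (cmod y)\<^sup>2"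
    for x y by (simp add: cmod_power2) (simp add: power2_eq_square algebra_simps)
  then show ?thesis
    using assms
    by (simp add: vnorm2_def scalar_prod_def atLeast0LessThan sum.distrib sum_distrib_left
        distrib_left)
qed

lemma vnorm2_smult: "vnorm2 (c \<cdot>\<^sub>v v) = (cmod c)\<^sup>2 * vnorm2 v"
  by (simp add: vnorm2_def norm_mult power_mult_distrib sum_distrib_left)

lemma mat_adjoint_carrier [simp]:
  "A \<in> carrier_mat n m \<Longrightarrow> mat_adjoint A \<in> carrier_mat m n"
  by (auto simp: mat_adjoint_def)

lemma mat_adjoint_cscalar_prod:
  fixes A :: "complex mat"
  assumes A: "A \<in> carrier_mat n m" and u: "u \<in> carrier_vec n" and v: "v \<in> carrier_vec m"
  shows "(mat_adjoint A *\<^sub>v u) \<bullet>c v = u \<bullet>c (A *\<^sub>v v)"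
proof -
  have "(mat_adjoint A *\<^sub>v u) $ i = (\<Sum>j<n. cnj (A $$ (j, i)) * u $ j)" if "i < m" for i
    using A u that by (simp add: mat_adjoint_def scalar_prod_def atLeast0LessThan mat_of_rows_row)
  then have "(mat_adjoint A *\<^sub>v u) \<bullet>c v = (\<Sum>i<m. (\<Sum>j<n. cnj (A $$ (j, i)) * u $ j) * cnj (v $ i))"
    using A u v by (simp add: scalar_prod_def[of "mat_adjoint A *\<^sub>v u"] atLeast0LessThan)
  also have "\<dots> = (\<Sum>j<n. \<Sum>i<m. cnj (A $$ (j, i)) * u $ j * cnj (v $ i))"
    unfolding sum_distrib_right by (rule sum.swap)
  also have "\<dots> = (\<Sum>j<n. u $ j * cnj (\<Sum>i<m. A $$ (j, i) * v $ i))"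
    by (simp add: sum_distrib_left mult_ac)
  also have "\<dots> = u \<bullet>c (A *\<^sub>v v)"
    using A u v by (simp add: scalar_prod_def atLeast0LessThan)
  finally show ?thesis .
qed

text \<open>A maximiser of the Rayleigh quotient of \<open>mat_adjoint A * A\<close> exists by
  compactness of the complex unit sphere; homogeneity carries the bound to all vectors. Dimension 0
  has no unit vector.\<close>

lemma maximal_gain_attained:
  assumes A: "A \<in> carrier_mat n n" and n: "0 < n"
  obtains c v where "v \<in> carrier_vec n" "v \<noteq> 0\<^sub>v n" "vnorm2 (A *\<^sub>v v) = c * vnorm2 v"
    "\<And>w. w \<in> carrier_vec n \<Longrightarrow> vnorm2 (A *\<^sub>v w) \<le> c * vnorm2 w"
proof -
  define C where "C = {x :: nat \<Rightarrow> complex. (\<forall>i\<in>{..<n}. x i \<in> UNIV) \<and>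
    (\<forall>i. i \<notin> {..<n} \<longrightarrow> x i = 0) \<and> (\<Sum>i<n. (norm (x i))\<^sup>2) = 1}"
  have C: "compact C" unfolding C_def by (intro compact_unit_sphere_fun) auto
  define F where "F x = (\<Sum>i<n. (cmod (\<Sum>j<n. A $$ (i, j) * x j))\<^sup>2)" for x
  have "continuous_on C F"
    unfolding F_def
    by (intro continuous_intros continuous_on_subset[OF continuous_on_product_coordinates]) auto
  moreover have "(\<lambda>i. if i = 0 then 1 else 0) \<in> C"
  proof -
    have "(\<Sum>i<n. (cmod (if i = 0 then 1 else 0))\<^sup>2) = (\<Sum>i<n. if i = 0 then 1 else 0)"
      by (intro sum.cong) auto
    then show ?thesis using n by (auto simp: C_def)
  qed
  ultimately obtain x where x: "x \<in> C" "\<And>y. y \<in> C \<Longrightarrow> F y \<le> F x"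
    using continuous_attains_sup[OF C] by blast
  have F: "vnorm2 (A *\<^sub>v vec n y) = F y" for y
    using A by (simp add: vnorm2_def F_def scalar_prod_def atLeast0LessThan)
  have C1: "vnorm2 (vec n y) = 1" if "y \<in> C" for y
    using that by (simp add: C_def vnorm2_def)
  show thesis
  proof (rule that[of "vec n x" "F x"])
    show "vec n x \<noteq> 0\<^sub>v n" using C1[OF x(1)] vnorm2_eq_0_iff[of "vec n x" n] by auto
    show "vnorm2 (A *\<^sub>v vec n x) = F x * vnorm2 (vec n x)" using C1[OF x(1)] F by simp
    fix w :: "complex vec" assume w: "w \<in> carrier_vec n"
    show "vnorm2 (A *\<^sub>v w) \<le> F x * vnorm2 w"
    proof (cases "w = 0\<^sub>v n")
      case True
      have "A *\<^sub>v w = 0\<^sub>v n" using A True by auto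
      then show ?thesis using True vnorm2_eq_0_iff[of "0\<^sub>v n" n] by simp
    next
      case False
      define r where "r = sqrt (vnorm2 w)"
      have r: "0 < r" "r\<^sup>2 = vnorm2 w" using vnorm2_pos[OF w False] by (auto simp: r_def)
      define y where "y i = (if i < n then w $ i / r else 0)" for i
      have w_eq: "w = of_real r \<cdot>\<^sub>v vec n y" using w r by (intro eq_vecI) (auto simp: y_def)
      then have "vnorm2 w = r\<^sup>2 * vnorm2 (vec n y)" by (simp add: vnorm2_smult)
      then have "vnorm2 (vec n y) = 1" using r vnorm2_pos[OF w False] by simp
      then have "y \<in> C" by (simp add: C_def vnorm2_def y_def)
      have "A *\<^sub>v w = of_real r \<cdot>\<^sub>v (A *\<^sub>v vec n y)"
        unfolding w_eq using A by (intro mult_mat_vec) auto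
      then have "vnorm2 (A *\<^sub>v w) = r\<^sup>2 * F y" by (simp add: vnorm2_smult F)
      also have "\<dots> \<le> r\<^sup>2 * F x" using x(2)[OF \<open>y \<in> C\<close>] by (intro mult_left_mono) auto
      finally show ?thesis using r by (simp add: mult.commute)
    qed
  qed auto
qed

text \<open>The form \<open>c \<parallel>w\<parallel>\<^sup>2 - \<parallel>A w\<parallel>\<^sup>2\<close> is nonnegative and vanishes at \<open>v\<close>, so its gradient at \<open>v\<close>
  vanishes.\<close>
lemma maximal_gain_eigenvector:
  assumes A: "A \<in> carrier_mat n n" and v: "v \<in> carrier_vec n"
    and eq: "vnorm2 (A *\<^sub>v v) = c * vnorm2 v"
    and le: "\<And>w. w \<in> carrier_vec n \<Longrightarrow> vnorm2 (A *\<^sub>v w) \<le> c * vnorm2 w"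
  shows "(mat_adjoint A * A) *\<^sub>v v = complex_of_real c \<cdot>\<^sub>v v"
proof -
  let ?Hv = "mat_adjoint A *\<^sub>v (A *\<^sub>v v)"
  \<comment> \<open>Up to a factor 2, this is the gradient of the form at \<open>v\<close>; moving
    along it makes the first-order term a multiple of \<open>vnorm2 u\<close>.\<close>
  define u where "u = complex_of_real c \<cdot>\<^sub>v v - ?Hv"
  have Av: "A *\<^sub>v v \<in> carrier_vec n" using A v by auto
  then have Hv: "?Hv \<in> carrier_vec n"
    by (rule mult_mat_vec_carrier[OF mat_adjoint_carrier[OF A]])
  have u: "u \<in> carrier_vec n" using v Hv by (simp add: u_def)
  have Au: "A *\<^sub>v u \<in> carrier_vec n" using A u by auto
  have "u \<bullet>c u = (complex_of_real c \<cdot>\<^sub>v v) \<bullet>c u - ?Hv \<bullet>c u"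
    using minus_scalar_prod_distrib[of "complex_of_real c \<cdot>\<^sub>v v" n ?Hv "conjugate u"] v Hv u
    by (simp flip: u_def)
  also have "?Hv \<bullet>c u = (A *\<^sub>v v) \<bullet>c (A *\<^sub>v u)"
    using mat_adjoint_cscalar_prod[OF A Av u] .
  finally have "complex_of_real (vnorm2 u) = c * (v \<bullet>c u) - (A *\<^sub>v v) \<bullet>c (A *\<^sub>v u)"
    using v u by (simp add: cscalar_prod_self)
  then have "Re (complex_of_real (vnorm2 u)) =
      Re (c * (v \<bullet>c u) - (A *\<^sub>v v) \<bullet>c (A *\<^sub>v u))"
    by (simp only:)
  then have uu: "vnorm2 u = c * Re (v \<bullet>c u) - Re ((A *\<^sub>v v) \<bullet>c (A *\<^sub>v u))"
    by simp
  define q where "q = c * vnorm2 u - vnorm2 (A *\<^sub>v u)"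
  have quad: "0 \<le> 2 * r * vnorm2 u + r\<^sup>2 * q" for r
  proof -
    let ?w = "v + complex_of_real r \<cdot>\<^sub>v u"
    have "A *\<^sub>v ?w = A *\<^sub>v v + complex_of_real r \<cdot>\<^sub>v (A *\<^sub>v u)"
      using A u v by (simp add: mult_add_distrib_mat_vec[of _ n n] mult_mat_vec[of _ n n])
    then have "0 \<le> c * vnorm2 ?w - vnorm2 (A *\<^sub>v v + complex_of_real r \<cdot>\<^sub>v (A *\<^sub>v u))"
      using le[of ?w] u v by simp
    then show ?thesis
      unfolding vnorm2_add_smult[OF u v] vnorm2_add_smult[OF Au Av] eq uu q_def
      by (simp add: algebra_simps)
  qed
  have "vnorm2 u = 0"
  proof (rule ccontr)
    assume "vnorm2 u \<noteq> 0"
    then have p: "0 < vnorm2 u" using vnorm2_nonneg[of u] by simp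
    \<comment> \<open>A step so short that at \<open>r = - t\<close> the negative linear term
      outweighs the quadratic one.\<close>
    define t where "t = vnorm2 u / (\<bar>q\<bar> + 1)"
    have t: "0 < t" "t * (\<bar>q\<bar> + 1) = vnorm2 u" using p by (auto simp: t_def)
    have "0 \<le> t * (t * q - 2 * vnorm2 u)"
      using quad[of "- t"] by (simp add: power2_eq_square algebra_simps)
    then have "2 * vnorm2 u \<le> t * q" using t(1) by (simp add: zero_le_mult_iff)
    also have "\<dots> \<le> t * (\<bar>q\<bar> + 1)" using t(1) by (intro mult_left_mono) auto
    finally show False using t p by simp
  qed
  then have "u = 0\<^sub>v n" using vnorm2_eq_0_iff[OF u] by simp
  moreover have "complex_of_real c \<cdot>\<^sub>v v \<in> carrier_vec n" using v by simp
  ultimately have "complex_of_real c \<cdot>\<^sub>v v = ?Hv"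
    unfolding u_def by (metis minus_vec_eq_zeroD Hv)
  moreover have "(mat_adjoint A * A) *\<^sub>v v = ?Hv"
    by (rule assoc_mult_mat_vec[OF mat_adjoint_carrier[OF A] A v])
  ultimately show ?thesis by simp
qed

text \<open>A vector of maximal gain is an eigenvector for \<open>c\<close>, so
  \<open>sqrt c\<close> is a singular value. Conversely, each singular value is the gain of an
  eigenvector and cannot exceed \<open>sqrt c\<close>.\<close>

lemma spectral_norm_eqI:
  assumes A: "A \<in> carrier_mat n n" and v: "v \<in> carrier_vec n" "v \<noteq> 0\<^sub>v n"
    and eq: "vnorm2 (A *\<^sub>v v) = c * vnorm2 v"
    and le: "\<And>w. w \<in> carrier_vec n \<Longrightarrow> vnorm2 (A *\<^sub>v w) \<le> c * vnorm2 w"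
  shows "spectral_norm A = sqrt c"
proof -
  define T where "T = {s. 0 \<le> s \<and> eigenvalue (mat_adjoint A * A) (complex_of_real (s\<^sup>2))}"
  have H: "mat_adjoint A * A \<in> carrier_mat n n" using A by (intro mult_carrier_mat) auto
  have c0: "0 \<le> c"
    using eq vnorm2_nonneg[of "A *\<^sub>v v"] vnorm2_pos[OF v] by (simp add: zero_le_mult_iff)
  \<comment> \<open>\<open>Max\<close> is meaningful only on a finite set; squaring embeds
    \<open>T\<close> into the finite spectrum because its members are nonnegative.\<close>
  have "finite T"
  proof (rule finite_imageD)
    have "(\<lambda>s. complex_of_real (s\<^sup>2)) ` T \<subseteq> spectrum (mat_adjoint A * A)"
      by (auto simp: T_def spectrum_def)
    then show "finite ((\<lambda>s. complex_of_real (s\<^sup>2)) ` T)"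
      using card_finite_spectrum(1)[OF H] finite_subset by blast
    show "inj_on (\<lambda>s. complex_of_real (s\<^sup>2)) T"
      by (rule inj_onI) (simp add: T_def power2_eq_iff_nonneg del: of_real_power)
  qed
  moreover have "sqrt c \<in> T"
  proof -
    have "eigenvector (mat_adjoint A * A) v (complex_of_real c)"
      unfolding eigenvector_def carrier_matD(1)[OF H] using maximal_gain_eigenvector[OF A v(1) eq le] v by simp
    then show ?thesis using c0 by (auto simp: T_def eigenvalue_def simp del: of_real_power)
  qed
  moreover have "s \<le> sqrt c" if s: "s \<in> T" for s
  proof -
    obtain w where "eigenvector (mat_adjoint A * A) w (complex_of_real (s\<^sup>2))"
      using s unfolding T_def eigenvalue_def by blast
    then have w: "w \<in> carrier_vec n" "w \<noteq> 0\<^sub>v n"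
      and ev: "(mat_adjoint A * A) *\<^sub>v w = complex_of_real (s\<^sup>2) \<cdot>\<^sub>v w"
      unfolding eigenvector_def carrier_matD(1)[OF H] by blast+
    have Aw: "A *\<^sub>v w \<in> carrier_vec n" using A w by auto
    have "complex_of_real (s\<^sup>2) * (w \<bullet>c w) = ((mat_adjoint A * A) *\<^sub>v w) \<bullet>c w"
      unfolding ev using smult_scalar_prod_distrib[of w n "conjugate w" "complex_of_real (s\<^sup>2)"] w
      by (simp del: of_real_power)
    also have "\<dots> = (A *\<^sub>v w) \<bullet>c (A *\<^sub>v w)"
      using mat_adjoint_cscalar_prod[OF A Aw w(1)] A w
      by (simp add: assoc_mult_mat_vec[of _ n n _ n])
    finally have "complex_of_real (s\<^sup>2 * vnorm2 w) = complex_of_real (vnorm2 (A *\<^sub>v w))"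
      by (simp only: cscalar_prod_self of_real_mult)
    then have "s\<^sup>2 * vnorm2 w = vnorm2 (A *\<^sub>v w)" by (simp only: of_real_eq_iff)
    then have "s\<^sup>2 * vnorm2 w \<le> c * vnorm2 w" using le[OF w(1)] by (simp only:)
    then have "s\<^sup>2 \<le> c" using vnorm2_pos[OF w] by (rule mult_right_le_imp_le)
    then show ?thesis by (rule real_le_rsqrt)
  qed
  ultimately show ?thesis unfolding spectral_norm_def T_def[symmetric] by (intro Max_eqI) auto
qed

text \<open>With the next two lemmas, this characterises the spectral norm as the least nonnegative
  gain bound; eigenvalues do not appear afterwards.\<close>

lemma spectral_norm_nonneg:
  assumes "A \<in> carrier_mat n n" "0 < n"
  shows "0 \<le> spectral_norm A"
proof -
  obtain c v where v: "v \<in> carrier_vec n" "v \<noteq> 0\<^sub>v n" and c: "vnorm2 (A *\<^sub>v v) = c * vnorm2 v"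
    "\<And>w. w \<in> carrier_vec n \<Longrightarrow> vnorm2 (A *\<^sub>v w) \<le> c * vnorm2 w"
    using maximal_gain_attained[OF assms] by blast
  have "0 \<le> c"
    using c(1) vnorm2_nonneg[of "A *\<^sub>v v"] vnorm2_pos[OF v] by (simp add: zero_le_mult_iff)
  then show ?thesis using spectral_norm_eqI[OF assms(1) v c] by simp
qed

lemma spectral_norm_bound:
  assumes "A \<in> carrier_mat n n" "0 < n" "w \<in> carrier_vec n"
  shows "vnorm2 (A *\<^sub>v w) \<le> (spectral_norm A)\<^sup>2 * vnorm2 w"
proof -
  obtain c v where v: "v \<in> carrier_vec n" "v \<noteq> 0\<^sub>v n" and c: "vnorm2 (A *\<^sub>v v) = c * vnorm2 v"
    "\<And>w. w \<in> carrier_vec n \<Longrightarrow> vnorm2 (A *\<^sub>v w) \<le> c * vnorm2 w"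
    using maximal_gain_attained[OF assms(1,2)] by blast
  have "0 \<le> c"
    using c(1) vnorm2_nonneg[of "A *\<^sub>v v"] vnorm2_pos[OF v] by (simp add: zero_le_mult_iff)
  then show ?thesis using spectral_norm_eqI[OF assms(1) v c] c(2)[OF assms(3)] by simp
qed

lemma spectral_norm_le:
  assumes "A \<in> carrier_mat n n" "0 < n" "0 \<le> s"
    and "\<And>w. w \<in> carrier_vec n \<Longrightarrow> vnorm2 (A *\<^sub>v w) \<le> s\<^sup>2 * vnorm2 w"
  shows "spectral_norm A \<le> s"
proof -
  obtain c v where v: "v \<in> carrier_vec n" "v \<noteq> 0\<^sub>v n" and c: "vnorm2 (A *\<^sub>v v) = c * vnorm2 v"
    "\<And>w. w \<in> carrier_vec n \<Longrightarrow> vnorm2 (A *\<^sub>v w) \<le> c * vnorm2 w"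
    using maximal_gain_attained[OF assms(1,2)] by blast
  have "c * vnorm2 v \<le> s\<^sup>2 * vnorm2 v" using assms(4)[OF v(1)] c(1) by (simp only:)
  then have "c \<le> s\<^sup>2" using vnorm2_pos[OF v] by (rule mult_right_le_imp_le)
  then show ?thesis
    using spectral_norm_eqI[OF assms(1) v c] assms(3) by (simp add: real_le_lsqrt)
qed

section \<open>Block diagonal matrices\<close>

text \<open>The label, counted from 0, of the block containing index \<open>i\<close>. It turns
  block structure into conditions on single entries. Indices past the last block get
  \<open>length ms\<close>.\<close>

fun block_index :: "nat list \<Rightarrow> nat \<Rightarrow> nat" where
  "block_index [] i = 0"
| "block_index (k # ks) i = (if i < k then 0 else Suc (block_index ks (i - k)))"

lemma block_index_less: "i < sum_list ms \<Longrightarrow> block_index ms i < length ms"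
  by (induction ms i rule: block_index.induct) auto

section \<open>Entrywise descriptions of the two sets of block matrices\<close>

lemma nonneg_mat_iff:
  assumes "A \<in> carrier_mat n m"
  shows "nonneg_mat A \<longleftrightarrow> (\<forall>i<n. \<forall>j<m. 0 \<le> A $$ (i, j))"
proof
  show "\<forall>i<n. \<forall>j<m. 0 \<le> A $$ (i, j)" if "nonneg_mat A"
    using that elements_matI[OF assms] unfolding nonneg_mat_def by blast
  show "nonneg_mat A" if nonneg: "\<forall>i<n. \<forall>j<m. 0 \<le> A $$ (i, j)"
    unfolding nonneg_mat_def
  proof
    fix a assume "a \<in> elements_mat A"
    then obtain i j where "i < n" "j < m" "a = A $$ (i, j)"
      using elements_matD[of a A] assms by auto
    then show "0 \<le> a" using nonneg by simp
  qed
qed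

lemma Delta_blocks_Nil: "Delta_blocks [] = {0\<^sub>m 0 0}"
  by (auto simp: Delta_blocks_def)

lemma Delta_blocks_Cons:
  "Delta_blocks (k # ms) =
    {four_block_mat D (0\<^sub>m (dim_row D) (dim_col B)) (0\<^sub>m (dim_row B) (dim_col D)) B | D B.
      D \<in> carrier_mat k k \<and> nonneg_mat D \<and> B \<in> Delta_blocks ms}"
  (is "?L = ?R")
proof (intro equalityI subsetI)
  fix A assume "A \<in> ?L"
  then obtain D Ds where "A = diag_block_mat (D # Ds)" "D \<in> carrier_mat k k \<and> nonneg_mat D"
    and "list_all2 (\<lambda>D k. D \<in> carrier_mat k k \<and> nonneg_mat D) Ds ms"
    unfolding Delta_blocks_def list_all2_Cons2 by blast
  then show "A \<in> ?R" unfolding Delta_blocks_def diag_block_mat.simps Let_def by blast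
next
  fix A assume "A \<in> ?R"
  then obtain D Ds where "D \<in> carrier_mat k k \<and> nonneg_mat D"
    and "list_all2 (\<lambda>D k. D \<in> carrier_mat k k \<and> nonneg_mat D) Ds ms"
    and "A = diag_block_mat (D # Ds)"
    unfolding Delta_blocks_def diag_block_mat.simps Let_def by blast
  moreover from this have
    "list_all2 (\<lambda>D k. D \<in> carrier_mat k k \<and> nonneg_mat D) (D # Ds) (k # ms)" by simp
  ultimately show "A \<in> ?L" unfolding Delta_blocks_def by blast
qed

text \<open>Induction splits off the first block as a corner of a two by two block matrix. The
  entrywise form is what the commutation argument and the rank-one witness use.\<close>

lemma Delta_blocks_iff:
  "A \<in> Delta_blocks ms \<longleftrightarrow>
    A \<in> carrier_mat (sum_list ms) (sum_list ms) \<and> nonneg_mat A \<and>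
    (\<forall>i<sum_list ms. \<forall>j<sum_list ms. block_index ms i \<noteq> block_index ms j \<longrightarrow> A $$ (i, j) = 0)"
proof (induction ms arbitrary: A)
  case Nil
  show ?case by (auto simp: Delta_blocks_Nil nonneg_mat_def elements_mat_def)
next
  case (Cons k ms)
  let ?n = "sum_list ms"
  show ?case (is "_ = ?R")
  proof
    assume "A \<in> Delta_blocks (k # ms)"
    then obtain D B where D: "D \<in> carrier_mat k k" "nonneg_mat D" and B: "B \<in> Delta_blocks ms"
      and A: "A = four_block_mat D (0\<^sub>m (dim_row D) (dim_col B)) (0\<^sub>m (dim_row B) (dim_col D)) B"
      unfolding Delta_blocks_Cons by blast
    have Bc: "B \<in> carrier_mat ?n ?n" and Bn: "nonneg_mat B"
      and B0: "\<And>i j. i < ?n \<Longrightarrow> j < ?n \<Longrightarrow> block_index ms i \<noteq> block_index ms j \<Longrightarrow> B $$ (i, j) = 0"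
      using B unfolding Cons.IH by blast+
    have Ac: "A \<in> carrier_mat (k + ?n) (k + ?n)" using A D(1) Bc by simp
    have idx: "A $$ (i, j) = (if i < k then if j < k then D $$ (i, j) else 0
        else if j < k then 0 else B $$ (i - k, j - k))" if "i < k + ?n" "j < k + ?n" for i j
      using that A D(1) Bc by auto
    have "0 \<le> A $$ (i, j)" if "i < k + ?n" "j < k + ?n" for i j
      using that D(2) Bn unfolding idx[OF that] nonneg_mat_iff[OF D(1)] nonneg_mat_iff[OF Bc]
      by auto
    then show ?R using Ac nonneg_mat_iff[OF Ac] B0 by (auto simp: idx)
  next
    assume R: ?R
    then have Ac: "A \<in> carrier_mat (k + ?n) (k + ?n)"
      and An: "\<And>i j. i < k + ?n \<Longrightarrow> j < k + ?n \<Longrightarrow> 0 \<le> A $$ (i, j)"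
      and A0: "\<And>i j. i < k + ?n \<Longrightarrow> j < k + ?n \<Longrightarrow>
        block_index (k # ms) i \<noteq> block_index (k # ms) j \<Longrightarrow> A $$ (i, j) = 0"
      using nonneg_mat_iff[of A "k + ?n" "k + ?n"] by auto
    define D where "D = mat k k (\<lambda>(i, j). A $$ (i, j))"
    define B where "B = mat ?n ?n (\<lambda>(i, j). A $$ (i + k, j + k))"
    have D: "D \<in> carrier_mat k k" and B: "B \<in> carrier_mat ?n ?n" by (auto simp: D_def B_def)
    have "nonneg_mat D" unfolding nonneg_mat_iff[OF D] using An by (auto simp: D_def)
    moreover have "B \<in> Delta_blocks ms"
      unfolding Cons.IH nonneg_mat_iff[OF B]
      using B An A0[of "i + k" "j + k" for i j] by (auto simp: B_def)
    moreover have "A = four_block_mat D (0\<^sub>m (dim_row D) (dim_col B)) (0\<^sub>m (dim_row B) (dim_col D)) B"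
    proof (rule eq_matI)
      fix i j
      assume "i < dim_row (four_block_mat D (0\<^sub>m (dim_row D) (dim_col B)) (0\<^sub>m (dim_row B) (dim_col D)) B)"
        and "j < dim_col (four_block_mat D (0\<^sub>m (dim_row D) (dim_col B)) (0\<^sub>m (dim_row B) (dim_col D)) B)"
      then have ij: "i < k + ?n" "j < k + ?n" using D B by auto
      then show "A $$ (i, j) = four_block_mat D (0\<^sub>m (dim_row D) (dim_col B)) (0\<^sub>m (dim_row B) (dim_col D)) B $$ (i, j)"
        using A0[OF ij] by (auto simp: D_def B_def)
    qed (use Ac D B in auto)
    ultimately show "A \<in> Delta_blocks (k # ms)" unfolding Delta_blocks_Cons using D by blast
  qed
qed

text \<open>The weights are a function on labels instead of a list, matching the form in which the
  separation argument delivers them.\<close>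

definition scalar_blocks :: "nat list \<Rightarrow> (nat \<Rightarrow> real) \<Rightarrow> real mat" where
  "scalar_blocks ms \<theta> = mat (sum_list ms) (sum_list ms)
     (\<lambda>(i, j). if i = j then \<theta> (block_index ms i) else 0)"

lemma scalar_blocks_carrier [simp]:
  "scalar_blocks ms \<theta> \<in> carrier_mat (sum_list ms) (sum_list ms)"
  by (simp add: scalar_blocks_def)

lemma diag_block_mat_scalars:
  assumes "length ts = length ms"
  shows "diag_block_mat (map2 (\<lambda>t k. t \<cdot>\<^sub>m 1\<^sub>m k) ts ms) = scalar_blocks ms (\<lambda>k. ts ! k)"
  using assms
proof (induction ts ms rule: list_induct2)
  case Nil
  show ?case by (auto simp: scalar_blocks_def)
next
  case (Cons t ts k ms)
  show ?case
    by (rule eq_matI) (auto simp: Cons.IH Let_def scalar_blocks_def)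
qed

lemma Theta_blocks_eq: "Theta_blocks ms = {scalar_blocks ms \<theta> | \<theta>. \<forall>k. 0 < \<theta> k}"
proof (intro equalityI subsetI)
  fix T assume "T \<in> Theta_blocks ms"
  then obtain ts where ts: "length ts = length ms" "\<forall>t\<in>set ts. 0 < t"
    and T: "T = scalar_blocks ms (\<lambda>k. ts ! k)"
    unfolding Theta_blocks_def using diag_block_mat_scalars by force
  \<comment> \<open>Positivity is required at every label, so the list is continued by 1.\<close>
  let ?\<theta> = "\<lambda>k. if k < length ms then ts ! k else 1"
  have "T = scalar_blocks ms ?\<theta>"
    unfolding T scalar_blocks_def using block_index_less[of _ ms] by (intro eq_matI) auto
  moreover have "\<forall>k. 0 < ?\<theta> k" using ts by auto
  ultimately show "T \<in> {scalar_blocks ms \<theta> | \<theta>. \<forall>k. 0 < \<theta> k}" by blast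
next
  fix T assume "T \<in> {scalar_blocks ms \<theta> | \<theta>. \<forall>k. 0 < \<theta> k}"
  then obtain \<theta> where \<theta>: "\<forall>k. 0 < \<theta> k" and T: "T = scalar_blocks ms \<theta>" by blast
  let ?ts = "map \<theta> [0..<length ms]"
  have "T = scalar_blocks ms (\<lambda>k. ?ts ! k)"
    unfolding T scalar_blocks_def using block_index_less[of _ ms] by (intro eq_matI) auto
  then have "T = diag_block_mat (map2 (\<lambda>t k. t \<cdot>\<^sub>m 1\<^sub>m k) ?ts ms)"
    using diag_block_mat_scalars[of ?ts ms] by simp
  moreover have "length ?ts = length ms" "\<forall>t\<in>set ?ts. 0 < t" using \<theta> by auto
  ultimately show "T \<in> Theta_blocks ms" unfolding Theta_blocks_def by blast
qed

lemma diag_powr_scalar_blocks: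
  "diag_powr (scalar_blocks ms \<theta>) a = scalar_blocks ms (\<lambda>k. \<theta> k powr a)"
  by (rule eq_matI) (auto simp: diag_powr_def scalar_blocks_def)

lemma scalar_blocks_mult_index:
  assumes "A \<in> carrier_mat (sum_list ms) (sum_list ms)" "i < sum_list ms" "j < sum_list ms"
  shows "(scalar_blocks ms \<theta> * A) $$ (i, j) = \<theta> (block_index ms i) * A $$ (i, j)"
    and "(A * scalar_blocks ms \<theta>) $$ (i, j) = A $$ (i, j) * \<theta> (block_index ms j)"
  using assms by (auto simp: scalar_blocks_def scalar_prod_def if_distrib if_distribR
      cong: if_cong)

text \<open>Wherever \<open>A\<close> has a nonzero entry, row and column carry the same label and
  hence the same scalar.\<close>

lemma Delta_blocks_commute:
  assumes "A \<in> Delta_blocks ms"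
  shows "A * scalar_blocks ms \<theta> = scalar_blocks ms \<theta> * A"
proof -
  have A: "A \<in> carrier_mat (sum_list ms) (sum_list ms)" using assms by (simp add: Delta_blocks_iff)
  show ?thesis
  proof (rule eq_matI)
    fix i j assume "i < dim_row (scalar_blocks ms \<theta> * A)" "j < dim_col (scalar_blocks ms \<theta> * A)"
    then have ij: "i < sum_list ms" "j < sum_list ms" using A by (auto simp: scalar_blocks_def)
    then show "(A * scalar_blocks ms \<theta>) $$ (i, j) = (scalar_blocks ms \<theta> * A) $$ (i, j)"
      unfolding scalar_blocks_mult_index[OF A ij]
      using assms by (cases "block_index ms i = block_index ms j") (auto simp: Delta_blocks_iff)
  qed (use A in \<open>auto simp: scalar_blocks_def\<close>)
qed

section \<open>The structured singular value of a nonnegative matrix\<close>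

lemma det_one_minus_eq_0_iff:
  fixes A :: "'a :: field mat"
  assumes A: "A \<in> carrier_mat n n"
  shows "det (1\<^sub>m n - A) = 0 \<longleftrightarrow> (\<exists>v \<in> carrier_vec n. v \<noteq> 0\<^sub>v n \<and> A *\<^sub>v v = v)"
proof -
  have eq: "(1\<^sub>m n - A) *\<^sub>v v = 0\<^sub>v n \<longleftrightarrow> A *\<^sub>v v = v" if v: "v \<in> carrier_vec n" for v
  proof -
    have "(1\<^sub>m n - A) *\<^sub>v v = v - A *\<^sub>v v"
      using minus_mult_distrib_mat_vec[OF one_carrier_mat A v] v by simp
    moreover have "v - v = 0\<^sub>v n" using v by simp
    moreover have "A *\<^sub>v v \<in> carrier_vec n" using A v by (rule mult_mat_vec_carrier)
    ultimately show ?thesis using v minus_vec_eq_zeroD[of v n "A *\<^sub>v v"] by metis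
  qed
  have "1\<^sub>m n - A \<in> carrier_mat n n" using A by (rule minus_carrier_mat)
  then show ?thesis using det_0_iff_vec_prod_zero[of "1\<^sub>m n - A" n] eq by blast
qed

text \<open>If \<open>v\<close> is fixed by \<open>M * X\<close>, then
  \<open>w = D *\<^sub>v v\<close> is fixed by \<open>(D * M * E) * X\<close>, because
  \<open>X\<close> commutes with \<open>D\<close> and \<open>E\<close> undoes \<open>D\<close>. The
  two norm bounds then multiply to at least 1.\<close>

lemma scaled_norm_mult_norm_ge_1:
  assumes n: "0 < n" and carr: "M \<in> carrier_mat n n" "X \<in> carrier_mat n n"
    "D \<in> carrier_mat n n" "E \<in> carrier_mat n n"
    and ED: "E * D = 1\<^sub>m n" and comm: "X * D = D * X" and det: "det (1\<^sub>m n - M * X) = 0"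
  shows "1 \<le> spectral_norm (D * M * E) * spectral_norm X"
proof -
  note cv = mult_mat_vec_carrier[where nr = n and n = n]
  have "M * X \<in> carrier_mat n n" using carr by simp
  then obtain v where v: "v \<in> carrier_vec n" "v \<noteq> 0\<^sub>v n" and MX: "(M * X) *\<^sub>v v = v"
    using det det_one_minus_eq_0_iff by blast
  define w where "w = D *\<^sub>v v"
  have Xv: "X *\<^sub>v v \<in> carrier_vec n" by (rule cv[OF carr(2) v(1)])
  have w: "w \<in> carrier_vec n" unfolding w_def by (rule cv[OF carr(3) v(1)])
  have Ew: "E *\<^sub>v w = v"
    unfolding w_def using assoc_mult_mat_vec[OF carr(4,3) v(1)] v(1) by (simp add: ED)
  have "w \<noteq> 0\<^sub>v n"
  proof
    assume "w = 0\<^sub>v n"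
    then have "v = 0\<^sub>v n" using Ew carr(4) by auto
    then show False using v(2) by simp
  qed
  then have wpos: "0 < vnorm2 w" by (rule vnorm2_pos[OF w])
  have Xw: "X *\<^sub>v w = D *\<^sub>v (X *\<^sub>v v)"
    unfolding w_def using assoc_mult_mat_vec[OF carr(2,3) v(1)] assoc_mult_mat_vec[OF carr(3,2) v(1)]
    by (simp only: comm)
  have Xwc: "X *\<^sub>v w \<in> carrier_vec n" by (rule cv[OF carr(2) w])
  have DM: "D * M \<in> carrier_mat n n" using carr by simp
  have DME: "D * M * E \<in> carrier_mat n n" using carr by simp
  have "E *\<^sub>v (X *\<^sub>v w) = X *\<^sub>v v"
    unfolding Xw using assoc_mult_mat_vec[OF carr(4,3) Xv] Xv by (simp add: ED)
  then have "(D * M * E) *\<^sub>v (X *\<^sub>v w) = D *\<^sub>v (M *\<^sub>v (X *\<^sub>v v))"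
    using assoc_mult_mat_vec[OF DM carr(4) Xwc] assoc_mult_mat_vec[OF carr(3,1) Xv]
    by (simp only:)
  also have "\<dots> = w"
    using assoc_mult_mat_vec[OF carr(1,2) v(1)] MX by (simp only: w_def)
  finally have "vnorm2 w \<le> (spectral_norm (D * M * E))\<^sup>2 * vnorm2 (X *\<^sub>v w)"
    using spectral_norm_bound[OF DME n Xwc] by (simp only:)
  also have "\<dots> \<le> (spectral_norm (D * M * E))\<^sup>2 * ((spectral_norm X)\<^sup>2 * vnorm2 w)"
    by (rule mult_left_mono[OF spectral_norm_bound[OF carr(2) n w]]) simp
  finally have "1 * vnorm2 w \<le> (spectral_norm (D * M * E) * spectral_norm X)\<^sup>2 * vnorm2 w"
    by (simp only: power_mult_distrib mult.assoc mult_1)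
  then have "1 \<le> (spectral_norm (D * M * E) * spectral_norm X)\<^sup>2"
    using wpos by (rule mult_right_le_imp_le)
  moreover have "0 \<le> spectral_norm (D * M * E) * spectral_norm X"
    using spectral_norm_nonneg[OF DME n] spectral_norm_nonneg[OF carr(2) n] by simp
  ultimately show ?thesis using abs_le_square_iff[of 1 "spectral_norm (D * M * E) * spectral_norm X"]
    by simp
qed

lemma Delta_blocks_scaled_norm_ge_1:
  assumes n: "0 < sum_list ms" and M: "M \<in> carrier_mat (sum_list ms) (sum_list ms)"
    and X: "X \<in> Delta_blocks ms" and \<theta>: "\<And>k. 0 < \<theta> k"
    and det: "det (1\<^sub>m (sum_list ms) - map_mat complex_of_real M * map_mat complex_of_real X) = 0"
  shows "1 \<le> spectral_norm (map_mat complex_of_real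
      (diag_powr (scalar_blocks ms \<theta>) (1 / 2) * M * diag_powr (scalar_blocks ms \<theta>) (- 1 / 2)))
    * spectral_norm (map_mat complex_of_real X)"
proof -
  let ?n = "sum_list ms"
  let ?c = "map_mat complex_of_real"
  define D where "D = diag_powr (scalar_blocks ms \<theta>) (1 / 2)"
  define E where "E = diag_powr (scalar_blocks ms \<theta>) (- 1 / 2)"
  have Xc: "X \<in> carrier_mat ?n ?n" using X by (simp add: Delta_blocks_iff)
  have D: "D \<in> carrier_mat ?n ?n" and E: "E \<in> carrier_mat ?n ?n"
    unfolding D_def E_def diag_powr_scalar_blocks by (rule scalar_blocks_carrier)+
  have "E * D = diag_powr (scalar_blocks ms \<theta>) (- 1 / 2 + 1 / 2)"
    unfolding D_def E_def by (rule diag_powr_mult[OF scalar_blocks_carrier])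
  also have "\<dots> = 1\<^sub>m ?n"
    using diag_powr_zero[OF scalar_blocks_carrier[of ms \<theta>]] \<theta> by (simp add: scalar_blocks_def)
  finally have ED: "?c E * ?c D = 1\<^sub>m ?n"
    by (simp only: of_real_hom.mat_hom_mult[OF E D, symmetric] of_real_hom.mat_hom_one)
  have "X * D = D * X"
    unfolding D_def diag_powr_scalar_blocks by (rule Delta_blocks_commute[OF X])
  then have comm: "?c X * ?c D = ?c D * ?c X"
    by (simp only: of_real_hom.mat_hom_mult[OF Xc D, symmetric]
        of_real_hom.mat_hom_mult[OF D Xc, symmetric])
  have DM: "D * M \<in> carrier_mat ?n ?n" using D M by simp
  have "?c (D * M * E) = ?c D * ?c M * ?c E"
    by (simp only: of_real_hom.mat_hom_mult[OF DM E] of_real_hom.mat_hom_mult[OF D M])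
  moreover have "1 \<le> spectral_norm (?c D * ?c M * ?c E) * spectral_norm (?c X)"
    using n M Xc D E ED comm det by (intro scaled_norm_mult_norm_ge_1[of ?n]) auto
  ultimately show ?thesis unfolding D_def E_def by (simp only:)
qed

section \<open>The hard inequality: consequences of the two alternatives\<close>

lemma scaling_imp_spectral_norm_le:
  assumes n: "0 < sum_list ms" and M: "M \<in> carrier_mat (sum_list ms) (sum_list ms)"
    and nonneg: "nonneg_mat M" and \<theta>: "\<And>k. 0 < \<theta> k" and \<sigma>: "0 \<le> \<sigma>"
    and le: "\<And>x. (\<And>i. i \<in> {..<sum_list ms} \<Longrightarrow> 0 \<le> x i) \<Longrightarrow>
        (\<Sum>i<sum_list ms. \<theta> (block_index ms i) * (\<Sum>j<sum_list ms. M $$ (i, j) * x j)\<^sup>2)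
        \<le> \<sigma>\<^sup>2 * (\<Sum>i<sum_list ms. \<theta> (block_index ms i) * (x i)\<^sup>2)"
  shows "spectral_norm (map_mat complex_of_real
      (diag_powr (scalar_blocks ms \<theta>) (1 / 2) * M * diag_powr (scalar_blocks ms \<theta>) (- 1 / 2))) \<le> \<sigma>"
proof -
  let ?n = "sum_list ms"
  define t where "t i = \<theta> (block_index ms i)" for i
  have t: "0 < t i" for i by (simp add: t_def \<theta>)
  define A where "A = diag_powr (scalar_blocks ms \<theta>) (1 / 2) * M * diag_powr (scalar_blocks ms \<theta>) (- 1 / 2)"
  have DM: "scalar_blocks ms (\<lambda>k. \<theta> k powr (1 / 2)) * M \<in> carrier_mat ?n ?n"
    by (rule mult_carrier_mat[OF scalar_blocks_carrier M])
  have A: "A \<in> carrier_mat ?n ?n"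
    unfolding A_def diag_powr_scalar_blocks by (rule mult_carrier_mat[OF DM scalar_blocks_carrier])
  have A_index: "A $$ (i, j) = t i powr (1 / 2) * M $$ (i, j) * t j powr (- 1 / 2)"
    if "i < ?n" "j < ?n" for i j
    unfolding A_def diag_powr_scalar_blocks t_def scalar_blocks_mult_index(2)[OF DM that]
      scalar_blocks_mult_index(1)[OF M that] by (rule refl)
  have half: "(t i powr (1 / 2))\<^sup>2 = t i" "t i * (t i powr (- 1 / 2))\<^sup>2 = 1" for i
  proof -
    show "(t i powr (1 / 2))\<^sup>2 = t i"
      using t[of i] by (simp add: power2_eq_square flip: powr_add)
    have "(t i powr (- 1 / 2))\<^sup>2 = t i powr (- 1)"
      by (simp add: power2_eq_square flip: powr_add)
    then show "t i * (t i powr (- 1 / 2))\<^sup>2 = 1"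
      using t[of i] by (simp add: powr_minus)
  qed
  have M0: "0 \<le> M $$ (i, j)" if "i < ?n" "j < ?n" for i j
    using nonneg that nonneg_mat_iff[OF M] by blast
  show ?thesis
    unfolding A_def[symmetric]
  proof (rule spectral_norm_le)
    show "map_mat complex_of_real A \<in> carrier_mat ?n ?n" using A by simp
    show "0 < ?n" "0 \<le> \<sigma>" by fact+
    fix w :: "complex vec" assume w: "w \<in> carrier_vec ?n"
    \<comment> \<open>The hypothesis covers only nonnegative vectors. Passing to moduli loses
      nothing for an upper bound, since \<open>M\<close> is nonnegative, and the weights in
      \<open>x\<close> undo the scaling: its weighted square sum is \<open>vnorm2 w\<close>.\<close>
    define x where "x j = t j powr (- 1 / 2) * cmod (w $ j)" for j
    have entry: "(cmod ((map_mat complex_of_real A *\<^sub>v w) $ i))\<^sup>2 \<le> t i * (\<Sum>j<?n. M $$ (i, j) * x j)\<^sup>2"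
      if i: "i < ?n" for i
    proof -
      have "(map_mat complex_of_real A *\<^sub>v w) $ i = (\<Sum>j<?n. complex_of_real (A $$ (i, j)) * w $ j)"
        using A w i by (simp add: scalar_prod_def atLeast0LessThan)
      then have "cmod ((map_mat complex_of_real A *\<^sub>v w) $ i)
          \<le> (\<Sum>j<?n. cmod (complex_of_real (A $$ (i, j)) * w $ j))"
        by (simp only: norm_sum)
      also have "\<dots> = (\<Sum>j<?n. t i powr (1 / 2) * (M $$ (i, j) * x j))"
        using i M0 by (intro sum.cong) (auto simp: norm_mult A_index x_def abs_mult)
      also have "\<dots> = t i powr (1 / 2) * (\<Sum>j<?n. M $$ (i, j) * x j)"
        by (rule sum_distrib_left[symmetric])
      finally have "(cmod ((map_mat complex_of_real A *\<^sub>v w) $ i))\<^sup>2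
          \<le> (t i powr (1 / 2) * (\<Sum>j<?n. M $$ (i, j) * x j))\<^sup>2"
        by (intro power_mono) auto
      then show ?thesis by (simp only: power_mult_distrib half)
    qed
    have "vnorm2 (map_mat complex_of_real A *\<^sub>v w)
        = (\<Sum>i<?n. (cmod ((map_mat complex_of_real A *\<^sub>v w) $ i))\<^sup>2)"
      using A unfolding vnorm2_def by simp
    also have "\<dots> \<le> (\<Sum>i<?n. t i * (\<Sum>j<?n. M $$ (i, j) * x j)\<^sup>2)"
      by (intro sum_mono entry) simp
    also have "\<dots> \<le> \<sigma>\<^sup>2 * (\<Sum>i<?n. t i * (x i)\<^sup>2)"
      unfolding t_def by (rule le) (simp add: x_def)
    also have "(\<Sum>i<?n. t i * (x i)\<^sup>2) = vnorm2 w"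
      unfolding vnorm2_def carrier_vecD[OF w]
    proof (rule sum.cong)
      fix i
      have "t i * (x i)\<^sup>2 = (t i * (t i powr (- 1 / 2))\<^sup>2) * (cmod (w $ i))\<^sup>2"
        by (simp only: x_def power_mult_distrib mult.assoc)
      then show "t i * (x i)\<^sup>2 = (cmod (w $ i))\<^sup>2" by (simp only: half mult_1)
    qed simp
    finally show "vnorm2 (map_mat complex_of_real A *\<^sub>v w) \<le> \<sigma>\<^sup>2 * vnorm2 w" .
  qed
qed

text \<open>Each diagonal block of the witness is the rank-one matrix of least norm sending the block of
  \<open>M x\<close> to the block of \<open>x\<close>; it is zero by \<open>a / 0 = 0\<close> if the block of \<open>M x\<close> vanishes.\<close>
lemma gain_imp_Delta_blocks:
  assumes n: "0 < sum_list ms" and M: "M \<in> carrier_mat (sum_list ms) (sum_list ms)"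
    and nonneg: "nonneg_mat M" and \<sigma>: "0 < \<sigma>"
    and x0: "\<And>i. i < sum_list ms \<Longrightarrow> 0 \<le> x i" and xne: "\<exists>i<sum_list ms. x i \<noteq> 0"
    and gain: "\<And>k. \<sigma>\<^sup>2 * (\<Sum>i\<in>{i \<in> {..<sum_list ms}. block_index ms i = k}. (x i)\<^sup>2)
      \<le> (\<Sum>i\<in>{i \<in> {..<sum_list ms}. block_index ms i = k}. (\<Sum>j<sum_list ms. M $$ (i, j) * x j)\<^sup>2)"
  obtains X where "X \<in> Delta_blocks ms"
    "det (1\<^sub>m (sum_list ms) - map_mat complex_of_real M * map_mat complex_of_real X) = 0"
    "spectral_norm (map_mat complex_of_real X) \<le> 1 / \<sigma>"
proof -
  define m where "m = sum_list ms"
  define b where "b = block_index ms"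
  define B where "B k = {i \<in> {..<m}. b i = k}" for k
  define y where "y i = (\<Sum>j<m. M $$ (i, j) * x j)" for i
  define s where "s k = (\<Sum>i\<in>B k. (y i)\<^sup>2)" for k
  define X where "X = mat m m (\<lambda>(i, j). if b i = b j then x i * y j / s (b i) else 0)"
  have Mc: "M \<in> carrier_mat m m" using M by (simp add: m_def)
  have X: "X \<in> carrier_mat m m" by (simp add: X_def)
  have s0: "0 \<le> s k" for k by (simp add: s_def sum_nonneg)
  have y0: "0 \<le> y i" if "i < m" for i
    unfolding y_def using nonneg nonneg_mat_iff[OF Mc] x0 that
    by (intro sum_nonneg mult_nonneg_nonneg) (auto simp: m_def)
  have gain': "\<sigma>\<^sup>2 * (\<Sum>i\<in>B k. (x i)\<^sup>2) \<le> s k" for k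
    using gain[of k] unfolding s_def y_def B_def m_def b_def .
  have finB: "finite (B k)" for k by (simp add: B_def)
  \<comment> \<open>By the gain inequality the block of \<open>x\<close> vanishes together with that
    of \<open>y\<close>, so the default \<open>x i / 0 = 0\<close> is the right value.\<close>
  have x_eq_0: "x i = 0" if "i < m" "s (b i) = 0" for i
  proof -
    have "\<sigma>\<^sup>2 * (\<Sum>j\<in>B (b i). (x j)\<^sup>2) \<le> 0" using gain'[of "b i"] that by simp
    then have "(\<Sum>j\<in>B (b i). (x j)\<^sup>2) \<le> 0" using \<sigma> by (simp add: mult_le_0_iff)
    moreover have "(x i)\<^sup>2 \<le> (\<Sum>j\<in>B (b i). (x j)\<^sup>2)"
      using that finB by (intro member_le_sum) (auto simp: B_def)
    ultimately have "(x i)\<^sup>2 \<le> 0" by linarith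
    then show ?thesis by simp
  qed
  \<comment> \<open>Stated over any real field, since it serves both the real vector
    \<open>y\<close> in \<open>Xy\<close> and the complex vectors \<open>w\<close> in the norm
    bound.\<close>
  have row: "(\<Sum>j<m. of_real (X $$ (i, j)) * z j) = of_real (x i / s (b i)) * (\<Sum>j\<in>B (b i). of_real (y j) * z j)"
    if "i < m" for i and z :: "nat \<Rightarrow> 'z :: real_field"
  proof -
    have "(\<Sum>j<m. of_real (X $$ (i, j)) * z j)
        = (\<Sum>j<m. if b j = b i then of_real (x i / s (b i)) * (of_real (y j) * z j) else 0)"
      using that by (intro sum.cong) (auto simp: X_def)
    also have "\<dots> = (\<Sum>j\<in>B (b i). of_real (x i / s (b i)) * (of_real (y j) * z j))"
      unfolding B_def by (rule sum.inter_filter[symmetric]) simp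
    finally show ?thesis by (simp only: sum_distrib_left)
  qed
  have Xy: "X *\<^sub>v vec m y = vec m x"
  proof (rule eq_vecI)
    fix i assume "i < dim_vec (vec m x)"
    then have i: "i < m" by simp
    have "(X *\<^sub>v vec m y) $ i = (\<Sum>j<m. X $$ (i, j) * y j)"
      using X i by (simp add: scalar_prod_def atLeast0LessThan)
    also have "\<dots> = x i / s (b i) * s (b i)"
      using row[OF i, of y] by (simp add: s_def power2_eq_square)
    also have "\<dots> = x i" using x_eq_0[OF i] by auto
    finally show "(X *\<^sub>v vec m y) $ i = vec m x $ i" using i by simp
  qed (use X in auto)
  have Mx: "M *\<^sub>v vec m x = vec m y"
    using Mc by (intro eq_vecI) (auto simp: y_def scalar_prod_def atLeast0LessThan)
  have MXc: "M * X \<in> carrier_mat m m" using Mc X by simp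
  have "(M * X) *\<^sub>v vec m y = vec m y"
    using assoc_mult_mat_vec[OF Mc X, of "vec m y"] Xy Mx by simp
  \<comment> \<open>Otherwise \<open>X\<close> would send 0 to \<open>x\<close>, against
    \<open>xne\<close>.\<close>
  moreover have "vec m y \<noteq> 0\<^sub>v m"
  proof
    assume "vec m y = 0\<^sub>v m"
    then have "vec m x = X *\<^sub>v 0\<^sub>v m" by (simp only: Xy[symmetric])
    also have "\<dots> = 0\<^sub>v m" using X by auto
    finally have "vec m x = 0\<^sub>v m" .
    moreover obtain i where "i < m" "x i \<noteq> 0" using xne by (auto simp: m_def)
    ultimately show False by (metis index_vec index_zero_vec(1))
  qed
  ultimately have "det (1\<^sub>m m - M * X) = 0"
    using det_one_minus_eq_0_iff[OF MXc] by (metis vec_carrier)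
  then have "complex_of_real (det (1\<^sub>m m - M * X)) = 0" by simp
  moreover have "map_mat complex_of_real (1\<^sub>m m - M * X)
      = 1\<^sub>m m - map_mat complex_of_real M * map_mat complex_of_real X"
    using Mc X unfolding of_real_hom.mat_hom_mult[OF Mc X, symmetric]
    by (intro eq_matI) auto
  ultimately have det: "det (1\<^sub>m m - map_mat complex_of_real M * map_mat complex_of_real X) = 0"
    using of_real_hom.hom_det[of "1\<^sub>m m - M * X"] by metis
  have "X \<in> Delta_blocks ms"
    unfolding Delta_blocks_iff m_def[symmetric] b_def[symmetric] nonneg_mat_iff[OF X]
    using X x0 y0 s0 by (auto simp: X_def m_def)
  moreover have "spectral_norm (map_mat complex_of_real X) \<le> 1 / \<sigma>"
  proof (rule spectral_norm_le)
    show "map_mat complex_of_real X \<in> carrier_mat m m" using X by simp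
    show "0 < m" "0 \<le> 1 / \<sigma>" using n \<sigma> by (auto simp: m_def)
    fix w :: "complex vec" assume w: "w \<in> carrier_vec m"
    define W where "W k = (\<Sum>j\<in>B k. (cmod (w $ j))\<^sup>2)" for k
    have W0: "0 \<le> W k" for k by (simp add: W_def sum_nonneg)
    \<comment> \<open>Cauchy-Schwarz within the block of \<open>i\<close>: only the part of
      \<open>w\<close> in that block is seen, with squared norm \<open>W (b i)\<close>.\<close>
    have entry: "(cmod ((map_mat complex_of_real X *\<^sub>v w) $ i))\<^sup>2 \<le> (W (b i) / s (b i)) * (x i)\<^sup>2"
      if i: "i < m" for i
    proof -
      let ?k = "b i"
      have "(map_mat complex_of_real X *\<^sub>v w) $ i = (\<Sum>j<m. of_real (X $$ (i, j)) * w $ j)"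
        using X w i by (simp add: scalar_prod_def atLeast0LessThan)
      also have "\<dots> = of_real (x i / s ?k) * (\<Sum>j\<in>B ?k. of_real (y j) * w $ j)"
        by (rule row[OF i])
      finally have "(cmod ((map_mat complex_of_real X *\<^sub>v w) $ i))\<^sup>2
          = (x i / s ?k)\<^sup>2 * (cmod (\<Sum>j\<in>B ?k. of_real (y j) * w $ j))\<^sup>2"
        by (simp only: norm_mult power_mult_distrib norm_of_real power2_abs)
      also have "(cmod (\<Sum>j\<in>B ?k. of_real (y j) * w $ j))\<^sup>2 \<le> (\<Sum>j\<in>B ?k. y j * cmod (w $ j))\<^sup>2"
      proof (rule power_mono)
        have "cmod (\<Sum>j\<in>B ?k. of_real (y j) * w $ j) \<le> (\<Sum>j\<in>B ?k. cmod (of_real (y j) * w $ j))"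
          by (rule norm_sum)
        also have "\<dots> = (\<Sum>j\<in>B ?k. y j * cmod (w $ j))"
          using y0 by (intro sum.cong) (auto simp: norm_mult B_def)
        finally show "cmod (\<Sum>j\<in>B ?k. of_real (y j) * w $ j) \<le> (\<Sum>j\<in>B ?k. y j * cmod (w $ j))" .
      qed simp
      also have "(\<Sum>j\<in>B ?k. y j * cmod (w $ j))\<^sup>2 \<le> s ?k * W ?k"
        unfolding s_def W_def by (rule Cauchy_Schwarz_ineq_sum)
      finally have "(cmod ((map_mat complex_of_real X *\<^sub>v w) $ i))\<^sup>2 \<le> (x i / s ?k)\<^sup>2 * (s ?k * W ?k)"
        by (simp add: mult_left_mono)
      also have "\<dots> = (W ?k / s ?k) * (x i)\<^sup>2"
        by (cases "s ?k = 0") (auto simp: power2_eq_square)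
      finally show ?thesis .
    qed
    have "vnorm2 (map_mat complex_of_real X *\<^sub>v w)
        = (\<Sum>i<m. (cmod ((map_mat complex_of_real X *\<^sub>v w) $ i))\<^sup>2)"
      using X unfolding vnorm2_def by simp
    also have "\<dots> \<le> (\<Sum>i<m. (W (b i) / s (b i)) * (x i)\<^sup>2)"
      by (intro sum_mono entry) simp
    also have "\<dots> = (\<Sum>k\<in>b ` {..<m}. (W k / s k) * (\<Sum>i\<in>B k. (x i)\<^sup>2))"
      unfolding B_def by (rule sum_over_blocks[symmetric]) simp
    \<comment> \<open>On each block, the gain bounds the squares of \<open>x\<close> by
      \<open>s k\<close> over the square of \<open>\<sigma>\<close>, and \<open>s k\<close> cancels.
      If \<open>s k = 0\<close>, the quotient \<open>W k / s k\<close> is 0 by default.\<close>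
    also have "\<dots> \<le> (\<Sum>k\<in>b ` {..<m}. (1 / \<sigma>)\<^sup>2 * W k)"
    proof (rule sum_mono)
      fix k
      have "(\<Sum>i\<in>B k. (x i)\<^sup>2) \<le> (1 / \<sigma>)\<^sup>2 * s k"
        using gain'[of k] \<sigma> by (simp add: field_simps)
      then have "(W k / s k) * (\<Sum>i\<in>B k. (x i)\<^sup>2) \<le> (W k / s k) * ((1 / \<sigma>)\<^sup>2 * s k)"
        by (rule mult_left_mono) (simp add: W0 s0)
      also have "\<dots> \<le> (1 / \<sigma>)\<^sup>2 * W k"
        using W0[of k] by (cases "s k = 0") auto
      finally show "(W k / s k) * (\<Sum>i\<in>B k. (x i)\<^sup>2) \<le> (1 / \<sigma>)\<^sup>2 * W k" .
    qed
    also have "\<dots> = (\<Sum>i<m. (1 / \<sigma>)\<^sup>2 * (cmod (w $ i))\<^sup>2)"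
      unfolding W_def B_def by (rule sum_over_blocks) simp
    also have "\<dots> = (1 / \<sigma>)\<^sup>2 * vnorm2 w"
      unfolding vnorm2_def carrier_vecD[OF w] by (rule sum_distrib_left[symmetric])
    finally show "vnorm2 (map_mat complex_of_real X *\<^sub>v w) \<le> (1 / \<sigma>)\<^sup>2 * vnorm2 w" .
  qed
  ultimately show thesis using that[of X] det unfolding m_def by blast
qed

theorem corollary9:
  fixes ms :: "nat list" and M :: "real mat"
  assumes "ms \<noteq> []"
    and "\<forall>k \<in> set ms. 1 \<le> k"
    and "M \<in> carrier_mat (sum_list ms) (sum_list ms)"
    and "nonneg_mat M"
  shows "structured_singular_value (map_mat complex_of_real M)
           (map_mat complex_of_real ` Delta_blocks ms) =
         (INF \<Theta> \<in> Theta_blocks ms.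
            spectral_norm (map_mat complex_of_real
              (diag_powr \<Theta> (1 / 2) * M * diag_powr \<Theta> (- 1 / 2))))"
proof -
  let ?n = "sum_list ms"
  let ?c = "map_mat complex_of_real"
  let ?\<nu> = "\<lambda>\<Theta>. spectral_norm (?c (diag_powr \<Theta> (1 / 2) * M * diag_powr \<Theta> (- 1 / 2)))"
  define S where "S = {X \<in> ?c ` Delta_blocks ms. det (1\<^sub>m ?n - ?c M * X) = 0}"
  define \<mu> where "\<mu> = structured_singular_value (?c M) (?c ` Delta_blocks ms)"
  have \<mu>_eq: "\<mu> = (if S = {} then 0 else 1 / Inf (spectral_norm ` S))"
    using assms(3) by (simp add: \<mu>_def structured_singular_value_def S_def Let_def)
  \<comment> \<open>A block of size at least 1 makes the dimension positive; in dimension 0 the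
    spectral norm would be unspecified.\<close>
  have "hd ms \<in> set ms" using assms(1) by simp
  then have n: "0 < ?n" using assms(2) by (metis gr0I not_one_le_zero sum_list_eq_0_iff)
  have \<nu>_nonneg: "0 \<le> ?\<nu> \<Theta>" if \<Theta>: "\<Theta> \<in> Theta_blocks ms" for \<Theta>
  proof (rule spectral_norm_nonneg[OF _ n])
    obtain \<theta> where \<theta>: "\<Theta> = scalar_blocks ms \<theta>" using \<Theta> unfolding Theta_blocks_eq by blast
    show "?c (diag_powr \<Theta> (1 / 2) * M * diag_powr \<Theta> (- 1 / 2)) \<in> carrier_mat ?n ?n"
      unfolding \<theta> diag_powr_scalar_blocks using mult_carrier_mat[OF mult_carrier_mat[OF
        scalar_blocks_carrier assms(3)] scalar_blocks_carrier] by simp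
  qed
  have ge_1: "1 \<le> ?\<nu> \<Theta> * spectral_norm X" if \<Theta>: "\<Theta> \<in> Theta_blocks ms" and X: "X \<in> S" for \<Theta> X
  proof -
    obtain \<theta> where "\<Theta> = scalar_blocks ms \<theta>" "\<And>k. 0 < \<theta> k"
      using \<Theta> unfolding Theta_blocks_eq by blast
    moreover obtain Y where "Y \<in> Delta_blocks ms" "X = ?c Y" "det (1\<^sub>m ?n - ?c M * ?c Y) = 0"
      using X by (auto simp: S_def)
    ultimately show ?thesis using Delta_blocks_scaled_norm_ge_1[OF n assms(3)] by blast
  qed
  have ne: "Theta_blocks ms \<noteq> {}"
    unfolding Theta_blocks_eq by (auto intro: exI[of _ "\<lambda>_. 1"])
  have bdd: "bdd_below (?\<nu> ` Theta_blocks ms)"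
    using \<nu>_nonneg by (intro bdd_belowI2[of _ 0]) auto
  have \<nu>_pos: "0 < ?\<nu> \<Theta>" and norm_ge: "1 / ?\<nu> \<Theta> \<le> spectral_norm X"
    if "\<Theta> \<in> Theta_blocks ms" "X \<in> S" for \<Theta> X
  proof -
    have "?\<nu> \<Theta> \<noteq> 0" using ge_1[OF that] by auto
    then show "0 < ?\<nu> \<Theta>" using \<nu>_nonneg[OF that(1)] by simp
    then show "1 / ?\<nu> \<Theta> \<le> spectral_norm X" using ge_1[OF that] by (simp add: field_simps)
  qed
  have Inf_ge: "1 / ?\<nu> \<Theta> \<le> Inf (spectral_norm ` S)" if "\<Theta> \<in> Theta_blocks ms" "S \<noteq> {}" for \<Theta>
    using norm_ge[OF that(1)] that(2) by (intro cINF_greatest) auto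
  have Inf_pos: "0 < Inf (spectral_norm ` S)" if Sne: "S \<noteq> {}"
  proof -
    obtain \<Theta> X where TX: "\<Theta> \<in> Theta_blocks ms" "X \<in> S" using ne Sne by blast
    then have "0 < 1 / ?\<nu> \<Theta>" using \<nu>_pos by simp
    then show ?thesis using Inf_ge[OF TX(1) Sne] by linarith
  qed
  have upper: "\<mu> \<le> (INF \<Theta> \<in> Theta_blocks ms. ?\<nu> \<Theta>)"
  proof (rule cINF_greatest[OF ne])
    fix \<Theta> assume \<Theta>: "\<Theta> \<in> Theta_blocks ms"
    show "\<mu> \<le> ?\<nu> \<Theta>"
    proof (cases "S = {}")
      case True
      then show ?thesis using \<nu>_nonneg[OF \<Theta>] by (simp add: \<mu>_eq)
    next
      case False
      then obtain X where "X \<in> S" by blast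
      then have "0 < ?\<nu> \<Theta>" by (rule \<nu>_pos[OF \<Theta>])
      then show ?thesis
        using Inf_ge[OF \<Theta> False] Inf_pos[OF False] False by (simp add: \<mu>_eq field_simps)
    qed
  qed
  have \<mu>_nonneg: "0 \<le> \<mu>" using Inf_pos by (simp add: \<mu>_eq less_imp_le)
  have lower: "(INF \<Theta> \<in> Theta_blocks ms. ?\<nu> \<Theta>) \<le> \<mu>"
  \<comment> \<open>Every \<open>\<sigma>\<close> above \<open>\<mu>\<close> is tested: a gain at
    level \<open>\<sigma>\<close> would yield a member of \<open>S\<close> of norm at most
    \<open>1 / \<sigma>\<close> and hence \<open>\<sigma> \<le> \<mu>\<close>, so the scaling
    alternative must hold.\<close>
  proof (rule dense_ge)
    fix \<sigma> assume "\<mu> < \<sigma>"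
    then have \<sigma>: "0 < \<sigma>" using \<mu>_nonneg by simp
    have I: "finite {..<?n}" "{..<?n} \<noteq> {}" using n by auto
    have M0: "0 \<le> M $$ (i, j)" if "i \<in> {..<?n}" "j \<in> {..<?n}" for i j
      using assms(4) nonneg_mat_iff[OF assms(3)] that by simp
    show "(INF \<Theta> \<in> Theta_blocks ms. ?\<nu> \<Theta>) \<le> \<sigma>"
    proof (rule block_gain_or_scaling[OF I, of "\<lambda>i j. M $$ (i, j)" \<sigma> "block_index ms"])
      fix x :: "nat \<Rightarrow> real"
      assume x: "\<And>i. i \<in> {..<?n} \<Longrightarrow> 0 \<le> x i" "\<exists>i\<in>{..<?n}. x i \<noteq> 0"
        "\<And>k. \<sigma>\<^sup>2 * (\<Sum>i\<in>{i \<in> {..<?n}. block_index ms i = k}. (x i)\<^sup>2)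
          \<le> (\<Sum>i\<in>{i \<in> {..<?n}. block_index ms i = k}. (\<Sum>j<?n. M $$ (i, j) * x j)\<^sup>2)"
      have x': "\<And>i. i < ?n \<Longrightarrow> 0 \<le> x i" "\<exists>i<?n. x i \<noteq> 0" using x(1,2) by auto
      obtain X where X: "X \<in> Delta_blocks ms" "det (1\<^sub>m ?n - ?c M * ?c X) = 0"
        and le: "spectral_norm (?c X) \<le> 1 / \<sigma>"
        by (rule gain_imp_Delta_blocks[OF n assms(3,4) \<sigma> x' x(3)])
      then have XS: "?c X \<in> S" by (auto simp: S_def)
      then have Sne: "S \<noteq> {}" by blast
      \<comment> \<open>Any scaling supplies the lower bound that makes the real infimum over
        \<open>S\<close> meaningful.\<close>
      obtain \<Theta> where "\<Theta> \<in> Theta_blocks ms" using ne by blast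
      then have "bdd_below (spectral_norm ` S)" using norm_ge by (intro bdd_belowI2) auto
      then have "Inf (spectral_norm ` S) \<le> 1 / \<sigma>"
        using XS le by (rule cINF_lower2)
      then have "\<sigma> \<le> \<mu>" using Inf_pos[OF Sne] Sne \<sigma> by (simp add: \<mu>_eq field_simps)
      then show ?thesis using \<open>\<mu> < \<sigma>\<close> by simp
    next
      fix \<theta> :: "nat \<Rightarrow> real"
      assume \<theta>: "\<And>k. 0 < \<theta> k"
        and le: "\<And>x. (\<And>i. i \<in> {..<?n} \<Longrightarrow> 0 \<le> x i) \<Longrightarrow>
          (\<Sum>i<?n. \<theta> (block_index ms i) * (\<Sum>j<?n. M $$ (i, j) * x j)\<^sup>2)
          \<le> \<sigma>\<^sup>2 * (\<Sum>i<?n. \<theta> (block_index ms i) * (x i)\<^sup>2)"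
      have "scalar_blocks ms \<theta> \<in> Theta_blocks ms" using \<theta> by (auto simp: Theta_blocks_eq)
      moreover have "?\<nu> (scalar_blocks ms \<theta>) \<le> \<sigma>"
        using \<sigma> by (intro scaling_imp_spectral_norm_le[OF n assms(3,4) \<theta> _ le]) auto
      ultimately show ?thesis by (rule cINF_lower2[OF bdd])
    qed (use M0 in auto)
  qed
  show ?thesis using upper lower unfolding \<mu>_def by (rule antisym)
qed

end
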